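(* Let $\mathcal{S}$ be the class of all finitely generated groups that embed as subgroups of R. Thompson's group $V$. Then $\mathcal{S}$ is closed under the following four operations: 1. passing to finitely generated subgroups: if $G\in\mathcal{S}$ and $H\le G$ is finitely generated, then $H\in\mathcal{S}$; 2. passing to finite index over-groups: if $G\in\mathcal{S}$ and $H$ is a group containing $G$ as a subgroup of finite index, then $H\in\mathcal{S}$; 3. taking finite direct products: if $G_1,\dots,G_k\in\mathcal{S}$, then $G_1\times\cdots\times G_k\in\mathcal{S}$; 4. taking restricted wreath products with any $\mathcal{CF}$ top group: if $G\in\mathcal{S}$ and $T$ is a $\mathcal{CF}$ group, then $G\wr T\in\mathcal{S}$.
   Context: Let $\mathfrak{C}_2 := \{0,1\}^\omega$ be the Cantor space of infinite binary strings with the product topology. A barrier is a finite set $\mathcal{B}\subset\{0,1\}^\ast$ of finite strings such that every element of $\{0,1\}^\omega$ has a unique string in $\mathcal{B}$ as a prefix. Given barriers $\mathcal{D},\mathcal{R}$ and a bijection $\sigma:\mathcal{D}\to\mathcal{R}$, the induced prefix replacement map is the map $\mathfrak{C}_2\to\mathfrak{C}_2$ sending $d\hat{x}\mapsto d^\sigma\hat{x}$ for all $d\in\mathcal{D}$, $\hat{x}\in\{0,1\}^\omega$. R. Thompson's group $V$ is the group of all prefix replacement maps of $\mathfrak{C}_2$ under composition. For a finitely generated group $T$ with finite generating set $\Sigma$ closed under inverses, the word problem $W(T)$ is the set of all words in the free monoid $\Sigma^\ast$ which represent the identity of $T$. A finitely generated group $T$ is a $\mathcal{CF}$ (context free) group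 if $W(T)$ is a context-free language (i.e. is accepted by a, possibly non-deterministic, push-down automaton). The restricted wreath product $G\wr T$ with top group $T$ is the semidirect product $\left(\bigoplus_{t\in T}G\right)\rtimes T$, where $T$ permutes the coordinates of the direct sum by its regular action on itself. *)

theory Defs
  imports "HOL-Algebra.Algebra" "HOL-Library.Stream"
begin

text \<open>Points of the Cantor space are streams of type \<^typ>\<open>bool stream\<close>;
  \<^term>\<open>d @- x\<close> is the finite string \<^term>\<open>d\<close> followed by the stream \<^term>\<open>x\<close>.\<close>

definition barrier :: "bool list set \<Rightarrow> bool" where
  "barrier B \<longleftrightarrow> finite B \<and> (\<forall>z :: bool stream. \<exists>!d. d \<in> B \<and> (\<exists>x. z = d @- x))"

text \<open>Since every stream has exactly one prefix in a barrier \<^term>\<open>D\<close>, the last conjunct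
  determines \<^term>\<open>f\<close> from \<^term>\<open>\<sigma>\<close>.\<close>

definition prefix_replacement_map :: "(bool stream \<Rightarrow> bool stream) \<Rightarrow> bool" where
  "prefix_replacement_map f \<longleftrightarrow>
     (\<exists>D R \<sigma>. barrier D \<and> barrier R \<and> bij_betw \<sigma> D R \<and> (\<forall>d\<in>D. \<forall>x. f (d @- x) = \<sigma> d @- x))"

definition thompson_V :: "(bool stream \<Rightarrow> bool stream) monoid" where
  "thompson_V = \<lparr>carrier = {f. prefix_replacement_map f}, monoid.mult = (\<lambda>f g. f \<circ> g), one = id\<rparr>"

definition finitely_generated :: "('a, 'x) monoid_scheme \<Rightarrow> bool" where
  "finitely_generated G \<longleftrightarrow> (\<exists>S. finite S \<and> S \<subseteq> carrier G \<and> generate G S = carrier G)"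

definition fg_subgroup_of_V :: "('a, 'x) monoid_scheme \<Rightarrow> bool" where
  "fg_subgroup_of_V G \<longleftrightarrow> group G \<and> finitely_generated G \<and> (\<exists>h. h \<in> mon G thompson_V)"

text \<open>A transition \<^term>\<open>(q, x, Z, q', \<beta>)\<close> of a push-down automaton is applicable in state
  \<^term>\<open>q\<close> with \<^term>\<open>Z\<close> on top of the stack; it reads the letter \<^term>\<open>a\<close> if
  \<^term>\<open>x = Some a\<close> and nothing if \<^term>\<open>x = None\<close>, replaces \<^term>\<open>Z\<close> by the string
  \<^term>\<open>\<beta>\<close>, and moves to \<^term>\<open>q'\<close>. The head of a stack list is its top.\<close>

record ('q, 'a, 's) pda =
  pda_states :: "'q set"
  pda_stack :: "'s set"
  pda_trans :: "('q \<times> 'a option \<times> 's \<times> 'q \<times> 's list) set"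
  pda_init :: "'q"
  pda_bottom :: "'s"
  pda_final :: "'q set"

definition is_pda :: "'a set \<Rightarrow> ('q, 'a, 's) pda \<Rightarrow> bool" where
  "is_pda A M \<longleftrightarrow>
     finite (pda_states M) \<and> finite (pda_stack M) \<and> finite (pda_trans M) \<and>
     pda_trans M \<subseteq>
       pda_states M \<times> insert None (Some ` A) \<times> pda_stack M \<times> pda_states M \<times> lists (pda_stack M) \<and>
     pda_init M \<in> pda_states M \<and> pda_bottom M \<in> pda_stack M \<and> pda_final M \<subseteq> pda_states M"

inductive pda_step ::
  "('q, 'a, 's) pda \<Rightarrow> 'q \<times> 'a list \<times> 's list \<Rightarrow> 'q \<times> 'a list \<times> 's list \<Rightarrow> bool"
  for M :: "('q, 'a, 's) pda" where
  silent: "(q, None, Z, q', \<beta>) \<in> pda_trans M \<Longrightarrow> pda_step M (q, w, Z # \<gamma>) (q', w, \<beta> @ \<gamma>)"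
| read: "(q, Some a, Z, q', \<beta>) \<in> pda_trans M \<Longrightarrow> pda_step M (q, a # w, Z # \<gamma>) (q', w, \<beta> @ \<gamma>)"

definition pda_language :: "('q, 'a, 's) pda \<Rightarrow> 'a list set" where
  "pda_language M =
     {w. \<exists>q\<in>pda_final M. \<exists>\<gamma>. (pda_step M)\<^sup>*\<^sup>* (pda_init M, w, [pda_bottom M]) (q, [], \<gamma>)}"

text \<open>States and stack symbols form finite sets, so taking them to be natural numbers is no
  restriction.\<close>

definition context_free :: "'a set \<Rightarrow> 'a list set \<Rightarrow> bool" where
  "context_free A L \<longleftrightarrow> finite A \<and> (\<exists>M :: (nat, 'a, nat) pda. is_pda A M \<and> pda_language M = L)"

definition word_problem :: "('a, 'x) monoid_scheme \<Rightarrow> 'a set \<Rightarrow> 'a list set" where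
  "word_problem T \<Sigma> = {w \<in> lists \<Sigma>. foldr (\<otimes>\<^bsub>T\<^esub>) w \<one>\<^bsub>T\<^esub> = \<one>\<^bsub>T\<^esub>}"

definition CF_group :: "('a, 'x) monoid_scheme \<Rightarrow> bool" where
  "CF_group T \<longleftrightarrow> group T \<and>
     (\<exists>\<Sigma>. finite \<Sigma> \<and> \<Sigma> \<subseteq> carrier T \<and> (\<forall>s\<in>\<Sigma>. inv\<^bsub>T\<^esub> s \<in> \<Sigma>) \<and> generate T \<Sigma> = carrier T \<and>
        context_free \<Sigma> (word_problem T \<Sigma>))"

definition semidirect_product ::
  "('n, 'x) monoid_scheme \<Rightarrow> ('k, 'y) monoid_scheme \<Rightarrow> ('k \<Rightarrow> 'n \<Rightarrow> 'n) \<Rightarrow> ('n \<times> 'k) monoid" where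
  "semidirect_product N K \<phi> =
     \<lparr>carrier = carrier N \<times> carrier K,
      monoid.mult = (\<lambda>(a, s) (b, t). (a \<otimes>\<^bsub>N\<^esub> \<phi> s b, s \<otimes>\<^bsub>K\<^esub> t)),
      one = (\<one>\<^bsub>N\<^esub>, \<one>\<^bsub>K\<^esub>)\<rparr>"

text \<open>The element \<^term>\<open>t\<close> carries the coordinate at \<^term>\<open>u\<close> to position \<^term>\<open>t \<otimes>\<^bsub>T\<^esub> u\<close>.\<close>

definition regular_shift :: "('t, 'y) monoid_scheme \<Rightarrow> 't \<Rightarrow> ('t \<Rightarrow> 'g) \<Rightarrow> 't \<Rightarrow> 'g" where
  "regular_shift T t f = (\<lambda>u\<in>carrier T. f (inv\<^bsub>T\<^esub> t \<otimes>\<^bsub>T\<^esub> u))"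

definition restricted_wreath_product ::
  "('g, 'x) monoid_scheme \<Rightarrow> ('t, 'y) monoid_scheme \<Rightarrow> (('t \<Rightarrow> 'g) \<times> 't) monoid" where
  "restricted_wreath_product G T =
     semidirect_product (sum_group (carrier T) (\<lambda>_. G)) T (regular_shift T)"

end

(* Elements of V are exactly the bijections of the Cantor space that are locally prefix replacements
   (compactness), so a group embeds into V as soon as it acts faithfully by such maps on I x Cantor
   space for a finite set I. Closure under finite index overgroups is then the induced action on
   cosets, and closure under products is the action on disjoint copies.

   For wreath products it suffices that T acts in this way with a clopen set U whose translates are
   pairwise disjoint: G then acts on U, and its conjugates act on the translates of U. Such an action is
   built from the cones of the Cayley graph, i.e. the components of the complements of balls around 1.
   Splitting a derivation of a closed path in a context-free grammar for the word problem shows that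
   the frontiers of cones have bounded diameter, hence there are finitely many cones up to
   translation. An element of T is coded by its position in the frontier of the smallest cone
   containing it, followed by the sequence of types of the surrounding cones, innermost first. A
   generator changes only the beginning of this code, that is, it acts by prefix replacement. *)

theory Submission
  imports Defs "HOL-Library.Sublist"
begin

section \<open>Locally prefix replacing bijections\<close>

text \<open>The top group has to act on every stream, although an element has only finitely many
  surrounding cones. Its code ends at the root, and what follows in the stream is arbitrary. This is
  the origin of the clopen set: at the root state for the identity there is nothing to decode, so
  its points fill a whole copy of the Cantor space, and an element carries this copy to the set of
  points that code it. Streams that never lead to the root describe no element; the action still
  makes sense on them, since two positions can be compared inside any cone that contains both. The
  order of the code is forced as well: a letter may lead out of a cone, and then exactly the next
  larger cone is needed. A type does not determine its parent, so the new position has to be correct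
  for every possible parent at once.\<close>

definition prefix_local :: "(bool stream \<Rightarrow> bool stream) \<Rightarrow> bool" where
  "prefix_local f \<longleftrightarrow> (\<forall>z. \<exists>d y e. z = d @- y \<and> (\<forall>x. f (d @- x) = e @- x))"

lemma shift_eq_shift_cases:
  assumes "d @- y = e @- z"
  obtains (left) c where "e = d @ c" "y = c @- z" | (right) c where "d = e @ c" "z = c @- y"
proof (cases "length d \<le> length e")
  case True
  have "stake (length d) (d @- y) = d" "sdrop (length d) (d @- y) = y" by (simp_all add: stake_shift sdrop_shift)
  with assms True have "d = take (length d) e" "y = drop (length d) e @- z"
    by (simp_all add: stake_shift sdrop_shift)
  then show ?thesis using left by (metis append_take_drop_id)
next
  case False
  have "stake (length e) (e @- z) = e" "sdrop (length e) (e @- z) = z" by (simp_all add: stake_shift sdrop_shift)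
  with assms[symmetric] False have "e = take (length e) d" "z = drop (length e) d @- y"
    by (simp_all add: stake_shift sdrop_shift)
  then show ?thesis using right by (metis append_take_drop_id)
qed

lemma shift_eq_shift_same_length:
  "length d = length e \<Longrightarrow> d @- y = e @- z \<longleftrightarrow> d = e \<and> y = z"
  by (metis shift_left_inj sdrop_shift sdrop.simps(1) stake_shift stake.simps(1) append_Nil2
      diff_self_eq_0 take_all order_refl)

text \<open>Koenig's lemma, that is, compactness of the Cantor space: a string without a uniform
  bound for its extensions has a one-letter extension without one, and the infinite branch found in
  this way would have no good prefix.\<close>

lemma uniform_prefix_length:
  fixes good :: "bool list \<Rightarrow> bool"
  assumes ext: "\<And>d e. good d \<Longrightarrow> good (d @ e)"
    and prefix: "\<And>z. \<exists>d y. z = d @- y \<and> good d"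
  shows "\<exists>n. \<forall>d. length d = n \<longrightarrow> good d"
proof (rule ccontr)
  assume neg: "\<not> ?thesis"
  define bad where "bad p \<longleftrightarrow> \<not> (\<exists>n. \<forall>q. length q = n \<longrightarrow> good (p @ q))" for p
  have bad_step: "bad (p @ [True]) \<or> bad (p @ [False])" if "bad p" for p
  proof (rule ccontr)
    assume "\<not> ?thesis"
    then obtain m n where m: "\<And>q. length q = m \<Longrightarrow> good ((p @ [True]) @ q)"
      and n: "\<And>q. length q = n \<Longrightarrow> good ((p @ [False]) @ q)"
      unfolding bad_def by blast
    have "good (p @ q)" if q: "length q = Suc (max m n)" for q
    proof -
      obtain a r where r: "q = a # r" "length r = max m n" using q by (cases q) auto
      \<comment> \<open>Behind the first letter of \<open>q\<close> already \<open>m\<close> or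
        \<open>n\<close> letters suffice; \<open>ext\<close> takes care of the others.\<close>
      define k where "k = (if a then m else n)"
      have "k \<le> length r" using r by (simp add: k_def)
      then have "good ((p @ [a]) @ take k r)" using m n by (cases a) (auto simp: k_def)
      then have "good (((p @ [a]) @ take k r) @ drop k r)" by (rule ext)
      then show ?thesis using r by simp
    qed
    then show False using that unfolding bad_def by blast
  qed
  define nxt where "nxt p \<longleftrightarrow> bad (p @ [True])" for p
  have bad_nxt: "bad (p @ [nxt p])" if "bad p" for p
    using bad_step[OF that] by (cases "nxt p") (auto simp: nxt_def)
  define ps where "ps n = ((\<lambda>p. p @ [nxt p]) ^^ n) []" for n
  have bad_ps: "bad (ps n)" for n
  proof (induction n)
    case 0
    then show ?case using neg by (simp add: ps_def bad_def)
  next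
    case (Suc n)
    then show ?case using bad_nxt by (simp add: ps_def)
  qed
  define z where "z = smap (\<lambda>n. nxt (ps n)) nats"
  have stake_z: "stake n z = ps n" for n
  proof (induction n)
    case (Suc n)
    have "z !! n = nxt (ps n)" by (simp add: z_def)
    then show ?case using Suc by (simp add: stake_Suc ps_def del: stake.simps)
  qed (simp add: ps_def)
  obtain d y where "z = d @- y" "good d" using prefix by blast
  then have "ps (length d) = d" using stake_z[of "length d"] by (simp add: stake_shift)
  then have "\<forall>q. length q = 0 \<longrightarrow> good (ps (length d) @ q)" using \<open>good d\<close> by simp
  then show False using bad_ps[of "length d"] unfolding bad_def by blast
qed

text \<open>The local form passes through compositions without any refinement of barriers.
  Conversely, compactness gives one length \<open>n\<close> that works everywhere, so all strings of
  length \<open>n\<close> serve as domain barrier, and bijectivity of \<open>f\<close> makes their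
  images a barrier.\<close>

lemma prefix_replacement_map_iff:
  "prefix_replacement_map f \<longleftrightarrow> bij f \<and> prefix_local f"
proof
  assume "prefix_replacement_map f"
  then obtain D R \<sigma> where D: "barrier D" and R: "barrier R" and \<sigma>: "bij_betw \<sigma> D R"
    and f: "\<And>d x. d \<in> D \<Longrightarrow> f (d @- x) = \<sigma> d @- x"
    unfolding prefix_replacement_map_def by blast
  have dec: "\<exists>d y. d \<in> D \<and> z = d @- y" for z using D unfolding barrier_def by blast
  have "inj f"
  proof (rule injI)
    fix x y assume eq: "f x = f y"
    obtain d x' where x: "d \<in> D" "x = d @- x'" using dec by blast
    obtain e y' where y: "e \<in> D" "y = e @- y'" using dec by blast
    have "\<sigma> d @- x' = \<sigma> e @- y'" using eq x y f by simp
    moreover have "\<sigma> d \<in> R" "\<sigma> e \<in> R" using x y \<sigma> by (auto simp: bij_betw_def)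
    ultimately have "\<sigma> d = \<sigma> e" using R unfolding barrier_def by metis
    then have "d = e" using x y \<sigma> by (auto simp: bij_betw_def inj_on_def)
    then show "x = y" using \<open>\<sigma> d @- x' = \<sigma> e @- y'\<close> x y by simp
  qed
  moreover have "\<exists>x. z = f x" for z
  proof -
    obtain r y where "r \<in> R" "z = r @- y" using R unfolding barrier_def by blast
    moreover obtain d where "d \<in> D" "\<sigma> d = r" using \<sigma> \<open>r \<in> R\<close> unfolding bij_betw_def by blast
    ultimately show ?thesis using f by metis
  qed
  ultimately have "bij f" unfolding bij_def surj_def by blast
  then show "bij f \<and> prefix_local f" using f dec unfolding prefix_local_def by meson
next
  assume "bij f \<and> prefix_local f"
  then have bij: "bij f" and loc: "prefix_local f" by auto
  define good where "good d \<longleftrightarrow> (\<exists>e. \<forall>x. f (d @- x) = e @- x)" for d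
  have "\<exists>n. \<forall>d. length d = n \<longrightarrow> good d"
  proof (rule uniform_prefix_length)
    fix d e assume "good d"
    then obtain c where "\<forall>x. f (d @- x) = c @- x" unfolding good_def by blast
    then have "\<forall>x. f ((d @ e) @- x) = (c @ e) @- x" by simp
    then show "good (d @ e)" unfolding good_def by blast
  next
    show "\<exists>d y. z = d @- y \<and> good d" for z
      using loc unfolding good_def prefix_local_def by blast
  qed
  then obtain n where n: "\<And>d. length d = n \<Longrightarrow> good d" by blast
  define D where "D = {d :: bool list. length d = n}"
  obtain \<sigma> where \<sigma>: "\<And>d x. d \<in> D \<Longrightarrow> f (d @- x) = \<sigma> d @- x"
    using n unfolding D_def good_def mem_Collect_eq by metis
  have finD: "finite D" using finite_lists_length_eq[of "UNIV :: bool set" n] by (simp add: D_def)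
  have dec: "\<exists>y. z = stake n z @- y" "stake n z \<in> D" for z
    by (metis stake_sdrop) (simp add: D_def)
  have sep: "d = e \<and> y = z" if "d \<in> D" "e \<in> D" "d @- y = e @- z" for d e y z
    using that shift_eq_shift_same_length[of d e y z] by (simp add: D_def)
  have sep': "d = e \<and> y = z" if "d \<in> D" "e \<in> D" "\<sigma> d @- y = \<sigma> e @- z" for d e y z
    using that \<sigma> sep bij by (metis bij_def injD)
  have "inj_on \<sigma> D" by (rule inj_onI) (use sep' in metis)
  moreover have "barrier D"
    unfolding barrier_def using finD dec sep by metis
  moreover have "barrier (\<sigma> ` D)"
    unfolding barrier_def
  proof (intro conjI allI)
    fix z
    obtain w where "z = f w" using bij by (metis bij_def surj_def)
    moreover obtain y where "w = stake n w @- y" using dec by blast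
    ultimately have z: "z = \<sigma> (stake n w) @- y" using \<sigma> dec by metis
    show "\<exists>!d. d \<in> \<sigma> ` D \<and> (\<exists>x. z = d @- x)"
    proof (rule ex1I[of _ "\<sigma> (stake n w)"])
      fix d assume "d \<in> \<sigma> ` D \<and> (\<exists>x. z = d @- x)"
      then obtain e x where "e \<in> D" "d = \<sigma> e" "z = \<sigma> e @- x" by blast
      then show "d = \<sigma> (stake n w)" using z sep' dec by metis
    qed (use z dec in blast)
  qed (use finD in simp)
  ultimately show "prefix_replacement_map f"
    unfolding prefix_replacement_map_def using \<sigma> by (metis bij_betw_imageI)
qed

text \<open>A comb: the new index receives the word \<open>[False]\<close>, and all earlier words
  move behind \<open>True\<close>. Such codes serve twice, to merge finitely many copies of the
  Cantor space into one and to record the choice of a parent cone.\<close>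

lemma ex_prefix_code:
  assumes "finite A" "A \<noteq> {}"
  shows "\<exists>b. bij_betw (\<lambda>(a, y). b a @- y) (A \<times> UNIV) (UNIV :: bool stream set)"
  using assms
proof (induction A rule: finite_ne_induct)
  case (singleton x)
  have "bij_betw (\<lambda>(a, y). [] @- y) ({x} \<times> UNIV) (UNIV :: bool stream set)"
    by (auto simp: bij_betw_def inj_on_def)
  then show ?case by (intro exI[of _ "\<lambda>_. []"]) simp
next
  case (insert x A)
  then obtain b where b: "bij_betw (\<lambda>(a, y). b a @- y) (A \<times> UNIV) (UNIV :: bool stream set)" by blast
  define c where "c = (\<lambda>a. if a = x then [False] else True # b a)"
  let ?h = "\<lambda>(a, y). c a @- y"
  have c: "c a = True # b a" if "a \<in> A" for a using that insert.hyps by (auto simp: c_def)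
  have b_inj: "a = a' \<and> y = y'" if "a \<in> A" "a' \<in> A" "b a @- y = b a' @- y'" for a a' y y'
    using inj_onD[OF bij_betw_imp_inj_on[OF b], of "(a, y)" "(a', y')"] that by simp
  have "inj_on ?h (insert x A \<times> UNIV)"
  proof (rule inj_onI, clarify)
    fix a y a' y'
    assume "a \<in> insert x A" "a' \<in> insert x A" "c a @- y = c a' @- y'"
    then show "a = a' \<and> y = y'"
      using b_inj[of a a' y y'] by (cases "a = x"; cases "a' = x") (simp_all add: c_def)
  qed
  moreover have "z \<in> ?h ` (insert x A \<times> UNIV)" for z
  proof (cases "shd z")
    case True
    obtain a y where "a \<in> A" "stl z = b a @- y"
    proof -
      have "stl z \<in> (\<lambda>(a, y). b a @- y) ` (A \<times> UNIV)" using b unfolding bij_betw_def by simp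
      then show ?thesis using that by auto
    qed
    then have "z = ?h (a, y)" using c True by (cases z) simp
    then show ?thesis using \<open>a \<in> A\<close> by blast
  next
    case False
    then have "z = ?h (x, stl z)" by (cases z) (simp add: c_def)
    then show ?thesis by blast
  qed
  ultimately have "bij_betw ?h (insert x A \<times> UNIV) UNIV" by (auto simp: bij_betw_def)
  then show ?case by blast
qed

section \<open>Actions on finitely many copies of the Cantor space\<close>

definition local_on :: "'i set \<Rightarrow> ('i \<times> bool stream \<Rightarrow> 'i \<times> bool stream) \<Rightarrow> bool" where
  "local_on I f \<longleftrightarrow> (\<forall>i\<in>I. \<forall>z. \<exists>d y j e. z = d @- y \<and> j \<in> I \<and> (\<forall>x. f (i, d @- x) = (j, e @- x)))"

lemma local_onD:
  "local_on I f \<Longrightarrow> i \<in> I \<Longrightarrow>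
    \<exists>d y j e. z = d @- y \<and> j \<in> I \<and> (\<forall>x. f (i, d @- x) = (j, e @- x))"
  unfolding local_on_def by blast

text \<open>The output prefix of \<open>f\<close> and the input prefix of \<open>g\<close> are
  prefixes of the same stream, hence comparable; the shorter one is lengthened by the missing piece
  \<open>c\<close>.\<close>

lemma local_on_comp:
  assumes f: "local_on I f" and g: "local_on I g"
    and h: "\<And>p. p \<in> I \<times> UNIV \<Longrightarrow> h p = g (f p)"
  shows "local_on I h"
  unfolding local_on_def
proof (intro ballI allI)
  fix i z assume i: "i \<in> I"
  obtain d y j e where 1: "z = d @- y" "j \<in> I" "\<And>x. f (i, d @- x) = (j, e @- x)"
    using local_onD[OF f i, of z] by blast
  obtain d' y' k e' where 2: "e @- y = d' @- y'" "k \<in> I" "\<And>x. g (j, d' @- x) = (k, e' @- x)"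
    using local_onD[OF g 1(2), of "e @- y"] by blast
  from 2(1) show "\<exists>d y j e. z = d @- y \<and> j \<in> I \<and> (\<forall>x. h (i, d @- x) = (j, e @- x))"
  proof (cases rule: shift_eq_shift_cases)
    case (left c)
    have "z = (d @ c) @- y'" using 1 left by simp
    moreover have "h (i, (d @ c) @- x) = (k, e' @- x)" for x
      using h i 1(3)[of "c @- x"] 2(3) left by simp
    ultimately show ?thesis using 2 by blast
  next
    case (right c)
    have "h (i, d @- x) = (k, (e' @ c) @- x)" for x
      using h i 1(3)[of x] 2(3)[of "c @- x"] right by simp
    then show ?thesis using 1 2 by blast
  qed
qed

text \<open>Each map is bijective on \<open>I \<times> UNIV\<close> because the inverse element acts
  as its inverse, so locality is the only condition on a single map.\<close>

definition cantor_action ::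
  "('g, 'x) monoid_scheme \<Rightarrow> 'i set \<Rightarrow> ('g \<Rightarrow> 'i \<times> bool stream \<Rightarrow> 'i \<times> bool stream) \<Rightarrow> bool" where
  "cantor_action H I \<phi> \<longleftrightarrow>
     (\<forall>p\<in>I \<times> UNIV. \<phi> \<one>\<^bsub>H\<^esub> p = p) \<and>
     (\<forall>g\<in>carrier H. \<forall>h\<in>carrier H. \<forall>p\<in>I \<times> UNIV. \<phi> (g \<otimes>\<^bsub>H\<^esub> h) p = \<phi> g (\<phi> h p)) \<and>
     (\<forall>g\<in>carrier H. local_on I (\<phi> g))"

lemma local_on_closed: "local_on I f \<Longrightarrow> p \<in> I \<times> UNIV \<Longrightarrow> f p \<in> I \<times> UNIV"
proof -
  assume f: "local_on I f" and p: "p \<in> I \<times> UNIV"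
  obtain i z where iz: "p = (i, z)" "i \<in> I" using p by blast
  show ?thesis using local_onD[OF f iz(2), of z] iz(1) by force
qed

lemma cantor_actionD:
  assumes "cantor_action H I \<phi>"
  shows "p \<in> I \<times> UNIV \<Longrightarrow> \<phi> \<one>\<^bsub>H\<^esub> p = p"
    and "g \<in> carrier H \<Longrightarrow> h \<in> carrier H \<Longrightarrow> p \<in> I \<times> UNIV \<Longrightarrow> \<phi> (g \<otimes>\<^bsub>H\<^esub> h) p = \<phi> g (\<phi> h p)"
    and "g \<in> carrier H \<Longrightarrow> local_on I (\<phi> g)"
    and "g \<in> carrier H \<Longrightarrow> p \<in> I \<times> UNIV \<Longrightarrow> \<phi> g p \<in> I \<times> UNIV"
  using assms local_on_closed unfolding cantor_action_def by blast+

text \<open>Conjugation by a prefix code for \<open>I\<close> merges the copies into one Cantor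
  space. Locality survives, since the code words are merely put in front of the prefixes that are
  exchanged.\<close>

lemma mon_thompson_V_if_cantor_action:
  assumes "group H" and I: "finite I" "I \<noteq> {}" and act: "cantor_action H I \<phi>"
    and faithful: "\<And>g. g \<in> carrier H \<Longrightarrow> (\<And>p. p \<in> I \<times> UNIV \<Longrightarrow> \<phi> g p = p) \<Longrightarrow> g = \<one>\<^bsub>H\<^esub>"
  shows "\<exists>h. h \<in> mon H thompson_V"
proof -
  interpret group H by fact
  obtain b where b: "bij_betw (\<lambda>(a, y). b a @- y) (I \<times> UNIV) (UNIV :: bool stream set)"
    using ex_prefix_code[OF I] by blast
  define enc where "enc = (\<lambda>(a, y). b a @- y :: bool stream)"
  define dec where "dec = inv_into (I \<times> UNIV) enc"
  have dec: "dec z \<in> I \<times> UNIV" "enc (dec z) = z" for z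
    using b unfolding dec_def enc_def bij_betw_def by (metis UNIV_I inv_into_into f_inv_into_f)+
  have dec_enc: "dec (enc p) = p" if "p \<in> I \<times> UNIV" for p
    using b that unfolding dec_def enc_def bij_betw_def by (metis inv_into_f_f)
  define \<theta> where "\<theta> g z = enc (\<phi> g (dec z))" for g z
  have \<theta>_mult: "\<theta> (g \<otimes>\<^bsub>H\<^esub> h) z = \<theta> g (\<theta> h z)" if "g \<in> carrier H" "h \<in> carrier H" for g h z
    using that cantor_actionD[OF act] dec dec_enc by (simp add: \<theta>_def)
  have \<theta>_one: "\<theta> \<one>\<^bsub>H\<^esub> z = z" for z
    using cantor_actionD[OF act] dec by (simp add: \<theta>_def)
  have "bij (\<theta> g)" if "g \<in> carrier H" for g
    by (rule o_bij[of "\<theta> (inv\<^bsub>H\<^esub> g)"]) (auto simp: fun_eq_iff that \<theta>_mult[symmetric] \<theta>_one)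
  moreover have "prefix_local (\<theta> g)" if g: "g \<in> carrier H" for g
    unfolding prefix_local_def
  proof
    fix z
    obtain i w where iw: "dec z = (i, w)" "i \<in> I" using dec(1)[of z] by auto
    obtain d y j e where 1: "w = d @- y" "j \<in> I" "\<And>x. \<phi> g (i, d @- x) = (j, e @- x)"
      using local_onD[OF cantor_actionD(3)[OF act g] iw(2), of w] by blast
    have "z = (b i @ d) @- y" using dec(2)[of z] iw 1 by (simp add: enc_def)
    moreover have "\<theta> g ((b i @ d) @- x) = (b j @ e) @- x" for x
      using dec_enc[of "(i, d @- x)"] iw 1 by (simp add: \<theta>_def enc_def)
    ultimately show "\<exists>d y e. z = d @- y \<and> (\<forall>x. \<theta> g (d @- x) = e @- x)" by blast
  qed
  ultimately have V: "\<theta> g \<in> carrier thompson_V" if "g \<in> carrier H" for g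
    using that by (simp add: thompson_V_def prefix_replacement_map_iff)
  have "g = \<one>\<^bsub>H\<^esub>" if "g \<in> carrier H" "\<theta> g = id" for g
  proof (rule faithful[OF that(1)])
    fix p assume p: "p \<in> I \<times> (UNIV :: bool stream set)"
    have "enc (\<phi> g p) = enc p" using fun_cong[OF that(2), of "enc p"] p dec_enc by (simp add: \<theta>_def)
    then show "\<phi> g p = p" using dec_enc cantor_actionD(4)[OF act that(1) p] p by metis
  qed
  note ker = this
  have "inj_on \<theta> (carrier H)"
  proof (rule inj_onI)
    fix g h assume gh: "g \<in> carrier H" "h \<in> carrier H" "\<theta> g = \<theta> h"
    have "\<theta> (inv\<^bsub>H\<^esub> h \<otimes>\<^bsub>H\<^esub> g) = id"
      using gh by (auto simp: fun_eq_iff \<theta>_mult \<theta>_mult[of "inv\<^bsub>H\<^esub> h" h, symmetric] \<theta>_one)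
    then have "inv\<^bsub>H\<^esub> h \<otimes>\<^bsub>H\<^esub> g = \<one>\<^bsub>H\<^esub>" using ker gh by simp
    then show "g = h" using gh by (metis inv_closed inv_equality inv_inv)
  qed
  then have "\<theta> \<in> mon H thompson_V"
    using V \<theta>_mult unfolding mon_def hom_def by (auto simp: thompson_V_def fun_eq_iff)
  then show ?thesis by blast
qed

lemma mon_thompson_VD:
  fixes G (structure)
  assumes "group G" "h \<in> mon G thompson_V"
  shows "h \<one>\<^bsub>G\<^esub> = id"
    and "a \<in> carrier G \<Longrightarrow> b \<in> carrier G \<Longrightarrow> h (a \<otimes>\<^bsub>G\<^esub> b) = h a \<circ> h b"
    and "a \<in> carrier G \<Longrightarrow> prefix_local (h a)"
    and "a \<in> carrier G \<Longrightarrow> (\<And>z. h a z = z) \<Longrightarrow> a = \<one>\<^bsub>G\<^esub>"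
proof -
  interpret group G by fact
  have V: "bij (h a)" "prefix_local (h a)" if "a \<in> carrier G" for a
    using assms(2) that by (auto simp: mon_def hom_def thompson_V_def prefix_replacement_map_iff Pi_iff)
  have mult: "h (a \<otimes>\<^bsub>G\<^esub> b) = h a \<circ> h b" if "a \<in> carrier G" "b \<in> carrier G" for a b
    using assms(2) that by (auto simp: mon_def hom_def thompson_V_def)
  \<comment> \<open>The image of \<open>\<one>\<close> is idempotent and injective, hence the
    identity.\<close>
  have "h \<one>\<^bsub>G\<^esub> \<circ> h \<one>\<^bsub>G\<^esub> = h \<one>\<^bsub>G\<^esub>" using mult[of \<one> \<one>] by simp
  then show one: "h \<one>\<^bsub>G\<^esub> = id"
    using V(1)[of \<one>] by (metis bij_is_inj comp_id fun.inj_map_strong inj_compose one_closed injD comp_def eq_id_iff)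
  show "a \<in> carrier G \<Longrightarrow> b \<in> carrier G \<Longrightarrow> h (a \<otimes>\<^bsub>G\<^esub> b) = h a \<circ> h b" by (rule mult)
  show "a \<in> carrier G \<Longrightarrow> prefix_local (h a)" by (rule V)
  assume a: "a \<in> carrier G" and "\<And>z. h a z = z"
  then have "h a = h \<one>\<^bsub>G\<^esub>" by (simp add: one fun_eq_iff)
  then show "a = \<one>\<^bsub>G\<^esub>" using a assms(2) by (auto simp: mon_def inj_on_def)
qed

section \<open>Finite index overgroups and direct products\<close>

lemma finitely_generatedI:
  assumes "group G" "finite S" "S \<subseteq> carrier G" "carrier G \<subseteq> generate G S"
  shows "finitely_generated G"
  using assms group.generate_incl[OF assms(1,3)] unfolding finitely_generated_def by blast

lemma fg_subgroup_of_VI: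
  assumes "group H" "finitely_generated H" "finite I" "I \<noteq> {}" "cantor_action H I \<phi>"
    and "\<And>g. g \<in> carrier H \<Longrightarrow> (\<And>p. p \<in> I \<times> UNIV \<Longrightarrow> \<phi> g p = p) \<Longrightarrow> g = \<one>\<^bsub>H\<^esub>"
  shows "fg_subgroup_of_V H"
  using assms mon_thompson_V_if_cantor_action[OF assms(1,3-6)] unfolding fg_subgroup_of_V_def by blast

lemma fg_subgroup_of_V_subgroup:
  assumes "fg_subgroup_of_V G" "subgroup H G" "finitely_generated (G\<lparr>carrier := H\<rparr>)"
  shows "fg_subgroup_of_V (G\<lparr>carrier := H\<rparr>)"
proof -
  obtain h where G: "group G" and h: "h \<in> mon G thompson_V"
    using assms(1) unfolding fg_subgroup_of_V_def by blast
  have "H \<subseteq> carrier G" using assms(2) by (rule subgroup.subset)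
  then have "h \<in> mon (G\<lparr>carrier := H\<rparr>) thompson_V"
    using h by (auto simp: mon_def hom_def inj_on_def Pi_iff subset_iff)
  then show ?thesis
    using assms subgroup.subgroup_is_group[OF assms(2) G] unfolding fg_subgroup_of_V_def by blast
qed

lemma local_on_second:
  assumes "\<And>i z. i \<in> I \<Longrightarrow> f (i, z) = (j i, \<rho> i z)"
    and "\<And>i. i \<in> I \<Longrightarrow> j i \<in> I" "\<And>i. i \<in> I \<Longrightarrow> prefix_local (\<rho> i)"
  shows "local_on I f"
  unfolding local_on_def
proof (intro ballI allI)
  fix i z assume i: "i \<in> I"
  obtain d y e where "z = d @- y" "\<And>x. \<rho> i (d @- x) = e @- x"
    using assms(3)[OF i] unfolding prefix_local_def by meson
  then show "\<exists>d y j e. z = d @- y \<and> j \<in> I \<and> (\<forall>x. f (i, d @- x) = (j, e @- x))"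
    using assms i by (intro exI[of _ d] exI[of _ y] exI[of _ "j i"] exI[of _ e]) simp
qed

text \<open>An induced representation: the copies are indexed by right cosets, and
  \<open>\<kappa> a c\<close> is the element of \<open>G\<close> by which \<open>a\<close> acts when
  it carries copy \<open>c\<close> to its new place, measured against the representatives
  \<open>r\<close>. The cocycle identity \<open>\<kappa>_mult\<close> is what makes
  \<open>\<phi>\<close> an action. Generators of \<open>G\<close> together with the representatives
  generate \<open>H\<close>.\<close>

lemma fg_subgroup_of_V_finite_index:
  assumes "group H" "subgroup G H" and fin: "finite (rcosets\<^bsub>H\<^esub> G)"
    and V: "fg_subgroup_of_V (H\<lparr>carrier := G\<rparr>)"
  shows "fg_subgroup_of_V H"
proof -
  interpret group H by fact
  interpret G: subgroup G H by fact
  let ?G = "H\<lparr>carrier := G\<rparr>"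
  obtain h where grp: "group ?G" and h: "h \<in> mon ?G thompson_V" and "finitely_generated ?G"
    using V unfolding fg_subgroup_of_V_def by blast
  note \<rho> = mon_thompson_VD[OF grp h, simplified]
  define I where "I = rcosets\<^bsub>H\<^esub> G"
  define r where "r c = (SOME a. a \<in> c)" for c :: "'a set"
  have rc: "r c \<in> c" "r c \<in> carrier H" "G #>\<^bsub>H\<^esub> r c = c" if c: "c \<in> I" for c
  proof -
    obtain a where a: "a \<in> carrier H" "c = G #>\<^bsub>H\<^esub> a" using c by (auto simp: I_def RCOSETS_def)
    show "r c \<in> c" unfolding r_def using rcos_self[OF a(1) assms(2)] a(2) by (metis someI)
    then show "G #>\<^bsub>H\<^esub> r c = c" using repr_independence[OF _ a(1) assms(2)] a(2) by simp
    show "r c \<in> carrier H"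
      using \<open>r c \<in> c\<close> G.rcosets_carrier[OF assms(1)] that by (auto simp: I_def)
  qed
  have cI: "G #>\<^bsub>H\<^esub> a \<in> I" if "a \<in> carrier H" for a
    using that G.subset by (simp add: I_def rcosetsI)
  have I_mult: "c #>\<^bsub>H\<^esub> a = G #>\<^bsub>H\<^esub> (r c \<otimes>\<^bsub>H\<^esub> a)" if "c \<in> I" "a \<in> carrier H" for c a
    using coset_mult_assoc[OF G.subset rc(2)[OF that(1)] that(2)] rc(3)[OF that(1)] by simp
  have I_closed: "c #>\<^bsub>H\<^esub> a \<in> I" if "c \<in> I" "a \<in> carrier H" for c a
    using that by (simp add: I_mult cI rc)
  have I_assoc: "c #>\<^bsub>H\<^esub> a #>\<^bsub>H\<^esub> b = c #>\<^bsub>H\<^esub> (a \<otimes>\<^bsub>H\<^esub> b)"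
    if "c \<in> I" "a \<in> carrier H" "b \<in> carrier H" for c a b
    using coset_mult_assoc[OF G.rcosets_carrier[OF assms(1)] that(2,3)] that(1) by (simp add: I_def)
  define \<kappa> where "\<kappa> a c = r (c #>\<^bsub>H\<^esub> inv\<^bsub>H\<^esub> a) \<otimes>\<^bsub>H\<^esub> a \<otimes>\<^bsub>H\<^esub> inv\<^bsub>H\<^esub> r c" for a c
  have \<kappa>: "\<kappa> a c \<in> G" if a: "a \<in> carrier H" and c: "c \<in> I" for a c
  proof -
    have "r (c #>\<^bsub>H\<^esub> inv\<^bsub>H\<^esub> a) \<in> G #>\<^bsub>H\<^esub> (r c \<otimes>\<^bsub>H\<^esub> inv\<^bsub>H\<^esub> a)"
      using rc(1)[OF I_closed[OF c]] I_mult[OF c] a by simp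
    then obtain g where g: "g \<in> G" "r (c #>\<^bsub>H\<^esub> inv\<^bsub>H\<^esub> a) = g \<otimes>\<^bsub>H\<^esub> (r c \<otimes>\<^bsub>H\<^esub> inv\<^bsub>H\<^esub> a)"
      by (auto simp: r_coset_def)
    then have "\<kappa> a c = g"
      using a rc(2)[OF c] G.subset by (simp add: \<kappa>_def m_assoc subset_iff inv_solve_right')
    then show ?thesis using g by simp
  qed
  have \<kappa>_mult: "\<kappa> (a \<otimes>\<^bsub>H\<^esub> b) c = \<kappa> a (c #>\<^bsub>H\<^esub> inv\<^bsub>H\<^esub> b) \<otimes>\<^bsub>H\<^esub> \<kappa> b c"
    if a: "a \<in> carrier H" and b: "b \<in> carrier H" and c: "c \<in> I" for a b c
  proof -
    let ?d = "c #>\<^bsub>H\<^esub> inv\<^bsub>H\<^esub> b"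
    let ?e = "c #>\<^bsub>H\<^esub> inv\<^bsub>H\<^esub> (a \<otimes>\<^bsub>H\<^esub> b)"
    have "?d #>\<^bsub>H\<^esub> inv\<^bsub>H\<^esub> a = ?e" using a b c by (simp add: I_assoc inv_mult_group)
    moreover have "r ?d \<in> carrier H" "r ?e \<in> carrier H" "r c \<in> carrier H"
      using a b c by (simp_all add: rc I_closed)
    ultimately show ?thesis using a b by (simp add: \<kappa>_def m_assoc inv_solve_left' flip: m_assoc[of "inv\<^bsub>H\<^esub> r ?d"])
  qed
  define \<phi> where "\<phi> a = (\<lambda>(c, z). (c #>\<^bsub>H\<^esub> inv\<^bsub>H\<^esub> a, h (\<kappa> a c) z))" for a
  have c_one: "c #>\<^bsub>H\<^esub> \<one>\<^bsub>H\<^esub> = c" if "c \<in> I" for c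
    using that G.rcosets_carrier[OF assms(1)] by (simp add: I_def coset_mult_one)
  have "\<kappa> \<one>\<^bsub>H\<^esub> c = \<one>\<^bsub>H\<^esub>" if "c \<in> I" for c
    using that rc by (simp add: \<kappa>_def c_one)
  then have act: "cantor_action H I \<phi>"
    unfolding cantor_action_def
    by (auto simp: \<phi>_def c_one \<rho>(1) \<kappa>_mult I_assoc inv_mult_group \<kappa> \<rho>(2) I_closed
        intro!: local_on_second[where j = "\<lambda>c. c #>\<^bsub>H\<^esub> inv\<^bsub>H\<^esub> _" and \<rho> = "\<lambda>c. h (\<kappa> _ c)"] \<rho>(3))
  have GI: "G \<in> I" using G.subgroup_in_rcosets[OF assms(1)] by (simp add: I_def)
  have faithful: "a = \<one>\<^bsub>H\<^esub>" if a: "a \<in> carrier H" and triv: "\<And>p. p \<in> I \<times> UNIV \<Longrightarrow> \<phi> a p = p" for a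
  proof -
    have triv_G: "G #>\<^bsub>H\<^esub> inv\<^bsub>H\<^esub> a = G" "\<And>z. h (\<kappa> a G) z = z" using triv[of "(G, _)"] GI by (auto simp: \<phi>_def)
    have "\<kappa> a G = \<one>\<^bsub>H\<^esub>" using \<rho>(4) \<kappa>[OF a GI] triv_G(2) by blast
    \<comment> \<open>Since \<open>a\<close> fixes the coset \<open>G\<close>, the cocycle there is
      the conjugate of \<open>a\<close> by \<open>r G\<close>, whatever representative was
      chosen.\<close>
    then have "r G \<otimes>\<^bsub>H\<^esub> a \<otimes>\<^bsub>H\<^esub> inv\<^bsub>H\<^esub> r G = \<one>\<^bsub>H\<^esub>" using triv_G(1) by (simp add: \<kappa>_def)
    then have "r G \<otimes>\<^bsub>H\<^esub> a = r G"
      using a rc(2)[OF GI] by (metis inv_equality inv_inv inv_closed m_closed)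
    then show ?thesis using a rc(2)[OF GI] by simp
  qed
  obtain S where S: "finite S" "S \<subseteq> G" "generate ?G S = G"
    using \<open>finitely_generated ?G\<close> unfolding finitely_generated_def by auto
  have "generate H S = G" using S generate_consistent[OF S(2) assms(2)] by simp
  have "finitely_generated H"
  proof (rule finitely_generatedI[OF assms(1), of "S \<union> r ` I"])
    show "finite (S \<union> r ` I)" using S fin by (simp add: I_def)
    show sub: "S \<union> r ` I \<subseteq> carrier H" using S G.subset rc by auto
    show "carrier H \<subseteq> generate H (S \<union> r ` I)"
    proof
      fix a assume a: "a \<in> carrier H"
      let ?c = "G #>\<^bsub>H\<^esub> a"
      have "a \<in> G #>\<^bsub>H\<^esub> r ?c" using rcos_self[OF a assms(2)] rc(3)[OF cI[OF a]] by simp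
      then obtain g where "g \<in> G" "a = g \<otimes>\<^bsub>H\<^esub> r ?c" by (auto simp: r_coset_def)
      moreover have "G \<subseteq> generate H (S \<union> r ` I)"
        using mono_generate[of S "S \<union> r ` I"] \<open>generate H S = G\<close> by auto
      ultimately show "a \<in> generate H (S \<union> r ` I)"
        using generate.eng[OF _ generate.incl, of g H "S \<union> r ` I" "r ?c"] cI[OF a] by auto
    qed
  qed
  then show ?thesis
    using fg_subgroup_of_VI[OF assms(1) _ _ _ act faithful] fin GI unfolding I_def by blast
qed

section \<open>Direct products\<close>

definition coord :: "'i set \<Rightarrow> ('i \<Rightarrow> ('g, 'x) monoid_scheme) \<Rightarrow> 'i \<Rightarrow> 'g \<Rightarrow> 'i \<Rightarrow> 'g" where
  "coord I G i x = (\<lambda>j\<in>I. if j = i then x else \<one>\<^bsub>G j\<^esub>)"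

text \<open>Coordinates are split off one at a time, by induction on the support. Stated for any
  index set, it covers both finite direct products and the base group of a wreath product.\<close>

lemma finite_support_induct:
  assumes G: "\<And>i. i \<in> I \<Longrightarrow> group (G i)"
    and one: "(\<lambda>i\<in>I. \<one>\<^bsub>G i\<^esub>) \<in> K"
    and mult: "\<And>a b. a \<in> K \<Longrightarrow> b \<in> K \<Longrightarrow> (\<lambda>i\<in>I. a i \<otimes>\<^bsub>G i\<^esub> b i) \<in> K"
    and coord: "\<And>i x. i \<in> I \<Longrightarrow> x \<in> carrier (G i) \<Longrightarrow> coord I G i x \<in> K"
    and f: "f \<in> (\<Pi>\<^sub>E i\<in>I. carrier (G i))" "finite {i \<in> I. f i \<noteq> \<one>\<^bsub>G i\<^esub>}"
  shows "f \<in> K"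
proof -
  have "f \<in> K" if "finite A" "{i \<in> I. f i \<noteq> \<one>\<^bsub>G i\<^esub>} = A" "f \<in> (\<Pi>\<^sub>E i\<in>I. carrier (G i))" for A f
    using that
  proof (induction A arbitrary: f rule: finite_induct)
    case empty
    then have "f = (\<lambda>i\<in>I. \<one>\<^bsub>G i\<^esub>)" by (auto simp: fun_eq_iff PiE_def extensional_def)
    then show ?case using one by metis
  next
    case (insert i A)
    have i: "i \<in> I" using insert.prems(1) by blast
    define f' where "f' = (\<lambda>j\<in>I. if j = i then \<one>\<^bsub>G i\<^esub> else f j)"
    have "f' \<in> (\<Pi>\<^sub>E i\<in>I. carrier (G i))"
      using insert.prems(2) G[THEN group.is_monoid, THEN monoid.one_closed] by (auto simp: f'_def PiE_iff)
    moreover have "{j \<in> I. f' j \<noteq> \<one>\<^bsub>G j\<^esub>} = A"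
      using insert.hyps insert.prems(1) by (auto simp: f'_def)
    ultimately have "f' \<in> K" using insert.IH by blast
    have fi: "f j \<in> carrier (G j)" if "j \<in> I" for j using insert.prems(2) that by (auto simp: PiE_iff)
    have "f = (\<lambda>j\<in>I. coord I G i (f i) j \<otimes>\<^bsub>G j\<^esub> f' j)"
      using insert.prems(2) fi G[THEN group.is_monoid, THEN monoid.r_one] G[THEN group.is_monoid, THEN monoid.l_one]
      by (auto simp: fun_eq_iff coord_def f'_def PiE_def extensional_def)
    then show ?case using mult[OF coord[OF i fi[OF i]] \<open>f' \<in> K\<close>] by simp
  qed
  then show ?thesis using f by blast
qed

lemma hom_generate_subset:
  assumes "group G" "group H" "e \<in> hom G H" "S \<subseteq> carrier G" "x \<in> generate G S" "e ` S \<subseteq> K"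
  shows "e x \<in> generate H K"
proof -
  interpret group_hom G H e using assms(1-3) by (simp add: group_hom_def group_hom_axioms_def)
  show ?thesis using generate_img[OF assms(4)] assms(5,6) H.mono_generate[OF assms(6)] by blast
qed

lemma coord_hom_product_group:
  assumes "\<And>i. i \<in> I \<Longrightarrow> group (G i)" "i \<in> I"
  shows "coord I G i \<in> hom (G i) (product_group I G)"
  using assms(2) assms(1)[THEN group.is_monoid, THEN monoid.one_closed]
    assms(1)[THEN group.is_monoid, THEN monoid.l_one]
  by (auto simp: hom_def coord_def fun_eq_iff)

lemma fg_subgroup_of_V_product_group:
  fixes k :: nat
  assumes V: "\<And>i. i \<in> {1..k} \<Longrightarrow> fg_subgroup_of_V (G i)"
  shows "fg_subgroup_of_V (product_group {1..k} G)"
proof -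
  let ?P = "product_group {1..k} G"
  have grp: "group (G i)" if "i \<in> {1..k}" for i using V[OF that] unfolding fg_subgroup_of_V_def by simp
  then interpret P: group ?P by (rule product_group)
  have "\<forall>i\<in>{1..k}. \<exists>h. h \<in> mon (G i) thompson_V" using V unfolding fg_subgroup_of_V_def by blast
  then obtain h where h: "\<And>i. i \<in> {1..k} \<Longrightarrow> h i \<in> mon (G i) thompson_V" by metis
  have \<rho>: "h i \<one>\<^bsub>G i\<^esub> = id"
    "\<And>a b. a \<in> carrier (G i) \<Longrightarrow> b \<in> carrier (G i) \<Longrightarrow> h i (a \<otimes>\<^bsub>G i\<^esub> b) = h i a \<circ> h i b"
    "\<And>a. a \<in> carrier (G i) \<Longrightarrow> prefix_local (h i a)"
    "\<And>a. a \<in> carrier (G i) \<Longrightarrow> (\<And>z. h i a z = z) \<Longrightarrow> a = \<one>\<^bsub>G i\<^esub>" if "i \<in> {1..k}" for i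
    using mon_thompson_VD[OF grp[OF that] h[OF that]] by blast+
  have "\<forall>i\<in>{1..k}. \<exists>S. finite S \<and> S \<subseteq> carrier (G i) \<and> generate (G i) S = carrier (G i)"
    using V unfolding fg_subgroup_of_V_def finitely_generated_def by blast
  then obtain S where S: "\<And>i. i \<in> {1..k} \<Longrightarrow> finite (S i) \<and> S i \<subseteq> carrier (G i) \<and> generate (G i) (S i) = carrier (G i)"
    by metis
  let ?K = "\<Union>i\<in>{1..k}. coord {1..k} G i ` S i"
  have c_hom: "coord {1..k} G i \<in> hom (G i) ?P" if "i \<in> {1..k}" for i
    using coord_hom_product_group[of "{1..k}" G] grp that by blast
  have fg: "finitely_generated ?P"
  proof (rule finitely_generatedI[OF P.is_group])
    show "finite ?K" using S by blast
    show "?K \<subseteq> carrier ?P" using c_hom S unfolding hom_def by blast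
    show "carrier ?P \<subseteq> generate ?P ?K"
    proof
      fix f assume f: "f \<in> carrier ?P"
      show "f \<in> generate ?P ?K"
      proof (rule finite_support_induct[where I = "{1..k}" and G = G])
        show "(\<lambda>i\<in>{1..k}. \<one>\<^bsub>G i\<^esub>) \<in> generate ?P ?K" using generate.one[of ?P ?K] by simp
        show "(\<lambda>i\<in>{1..k}. a i \<otimes>\<^bsub>G i\<^esub> b i) \<in> generate ?P ?K"
          if "a \<in> generate ?P ?K" "b \<in> generate ?P ?K" for a b
          using generate.eng[OF that] by simp
        show "coord {1..k} G i x \<in> generate ?P ?K" if "i \<in> {1..k}" "x \<in> carrier (G i)" for i x
          by (rule hom_generate_subset[OF grp[OF that(1)] P.is_group c_hom[OF that(1)], of "S i"])
            (use S[OF that(1)] that in auto)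
      qed (use f grp in auto)
    qed
  qed
  \<comment> \<open>Copy \<open>0\<close> carries the trivial action; it keeps the index set
    nonempty when \<open>k = 0\<close>.\<close>
  define \<phi> where "\<phi> g = (\<lambda>(i, z). (i, if i = 0 then z else h i (g i) z))" for g
  have act: "cantor_action ?P {0..k} \<phi>"
    unfolding cantor_action_def
  proof (intro conjI ballI)
    show "local_on {0..k} (\<phi> g)" if "g \<in> carrier ?P" for g
    proof (rule local_on_second)
      show "\<phi> g (i, z) = (i, (if i = 0 then (\<lambda>z. z) else h i (g i)) z)" for i z
        by (simp add: \<phi>_def)
      show "prefix_local (if i = 0 then (\<lambda>z. z) else h i (g i))" if "i \<in> {0..k}" for i
      proof (cases "i = 0")
        case True
        have "prefix_local (\<lambda>z. z)" unfolding prefix_local_def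
          by (intro allI exI[of _ "[]"] exI conjI) (rule shift.simps(1)[symmetric], simp)
        then show ?thesis using True by simp
      next
        case False
        then have i: "i \<in> {1..k}" using that by simp
        then have "g i \<in> carrier (G i)" using \<open>g \<in> carrier ?P\<close> by (auto simp: PiE_iff)
        then show ?thesis using \<rho>(3)[OF i] False by simp
      qed
    qed
  qed (auto simp: \<phi>_def \<rho>(1,2) PiE_iff)
  show ?thesis
  proof (rule fg_subgroup_of_VI[OF P.is_group fg _ _ act])
    fix g assume g: "g \<in> carrier ?P" and triv: "\<And>p. p \<in> {0..k} \<times> UNIV \<Longrightarrow> \<phi> g p = p"
    have "g i = \<one>\<^bsub>G i\<^esub>" if i: "i \<in> {1..k}" for i
    proof (rule \<rho>(4)[OF i])
      show "g i \<in> carrier (G i)" using g i by auto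
      show "h i (g i) z = z" for z using triv[of "(i, z)"] i by (simp add: \<phi>_def)
    qed
    then show "g = \<one>\<^bsub>?P\<^esub>" using g by (auto simp: fun_eq_iff PiE_def extensional_def)
  qed auto
qed

section \<open>Wreath products\<close>

lemma semidirect_product_group:
  assumes "group N" "group K"
    and hom: "\<And>s. s \<in> carrier K \<Longrightarrow> \<phi> s \<in> hom N N"
    and one: "\<And>n. n \<in> carrier N \<Longrightarrow> \<phi> \<one>\<^bsub>K\<^esub> n = n"
    and mult: "\<And>s t n. s \<in> carrier K \<Longrightarrow> t \<in> carrier K \<Longrightarrow> n \<in> carrier N \<Longrightarrow> \<phi> (s \<otimes>\<^bsub>K\<^esub> t) n = \<phi> s (\<phi> t n)"
  shows "group (semidirect_product N K \<phi>)"
proof -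
  interpret N: group N by fact
  interpret K: group K by fact
  have cl: "\<phi> s n \<in> carrier N" if "s \<in> carrier K" "n \<in> carrier N" for s n
    using hom[OF that(1)] that(2) by (auto simp: hom_def)
  have dist: "\<phi> s (m \<otimes>\<^bsub>N\<^esub> n) = \<phi> s m \<otimes>\<^bsub>N\<^esub> \<phi> s n" if "s \<in> carrier K" "m \<in> carrier N" "n \<in> carrier N" for s m n
    using hom[OF that(1)] that(2,3) by (auto simp: hom_def)
  have \<phi>1: "\<phi> s \<one>\<^bsub>N\<^esub> = \<one>\<^bsub>N\<^esub>" if "s \<in> carrier K" for s
    using hom_one[OF hom[OF that] assms(1,1)] .
  show ?thesis
  proof (rule groupI)
    fix x assume x: "x \<in> carrier (semidirect_product N K \<phi>)"
    then obtain a s where as: "x = (a, s)" "a \<in> carrier N" "s \<in> carrier K"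
      by (auto simp: semidirect_product_def)
    have "\<phi> (inv\<^bsub>K\<^esub> s) (inv\<^bsub>N\<^esub> a) \<otimes>\<^bsub>N\<^esub> \<phi> (inv\<^bsub>K\<^esub> s) a = \<one>\<^bsub>N\<^esub>"
      using as by (simp add: \<phi>1 flip: dist)
    then show "\<exists>y\<in>carrier (semidirect_product N K \<phi>). y \<otimes>\<^bsub>semidirect_product N K \<phi>\<^esub> x = \<one>\<^bsub>semidirect_product N K \<phi>\<^esub>"
      using as cl by (intro bexI[of _ "(\<phi> (inv\<^bsub>K\<^esub> s) (inv\<^bsub>N\<^esub> a), inv\<^bsub>K\<^esub> s)"]) (auto simp: semidirect_product_def)
  qed (auto simp: semidirect_product_def cl dist mult one N.m_assoc K.m_assoc)
qed

locale wreath =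
  G: group G + T: group T for G :: "('g, 'x) monoid_scheme" and T :: "('t, 'y) monoid_scheme"
begin

abbreviation "N \<equiv> sum_group (carrier T) (\<lambda>_. G)"
abbreviation "W \<equiv> restricted_wreath_product G T"
abbreviation "base \<equiv> coord (carrier T) (\<lambda>_. G)"
abbreviation "one\<^sub>N \<equiv> (\<lambda>_\<in>carrier T. \<one>\<^bsub>G\<^esub>)"

lemma carrier_N: "carrier N = {f \<in> carrier T \<rightarrow>\<^sub>E carrier G. finite {u \<in> carrier T. f u \<noteq> \<one>\<^bsub>G\<^esub>}}"
  by (rule carrier_sum_group) (rule G.is_group)

lemma N_group: "group N"
  by (rule sum_group) (rule G.is_group)

lemma one_N: "one\<^sub>N \<in> carrier N"
  by (simp add: carrier_N)

lemma shift_closed: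
  assumes t: "t \<in> carrier T" and f: "f \<in> carrier N"
  shows "regular_shift T t f \<in> carrier N"
proof -
  have "{u \<in> carrier T. regular_shift T t f u \<noteq> \<one>\<^bsub>G\<^esub>} \<subseteq> (\<lambda>u. t \<otimes>\<^bsub>T\<^esub> u) ` {u \<in> carrier T. f u \<noteq> \<one>\<^bsub>G\<^esub>}"
  proof
    fix u assume u: "u \<in> {u \<in> carrier T. regular_shift T t f u \<noteq> \<one>\<^bsub>G\<^esub>}"
    then have "u = t \<otimes>\<^bsub>T\<^esub> (inv\<^bsub>T\<^esub> t \<otimes>\<^bsub>T\<^esub> u)" using t by (simp flip: T.m_assoc)
    then show "u \<in> (\<lambda>u. t \<otimes>\<^bsub>T\<^esub> u) ` {u \<in> carrier T. f u \<noteq> \<one>\<^bsub>G\<^esub>}"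
      using u t by (intro image_eqI) (auto simp: regular_shift_def)
  qed
  then have "finite {u \<in> carrier T. regular_shift T t f u \<noteq> \<one>\<^bsub>G\<^esub>}"
    by (rule finite_subset) (use f in \<open>simp add: carrier_N\<close>)
  then show ?thesis using t f by (auto simp: carrier_N regular_shift_def)
qed

lemma W_group: "group W"
  unfolding restricted_wreath_product_def
proof (rule semidirect_product_group[OF N_group T.is_group])
  show "regular_shift T s \<in> hom N N" if "s \<in> carrier T" for s
    using that shift_closed by (auto simp: hom_def regular_shift_def fun_eq_iff)
  show "regular_shift T \<one>\<^bsub>T\<^esub> n = n" if "n \<in> carrier N" for n
    using that by (auto simp: carrier_N regular_shift_def fun_eq_iff PiE_def extensional_def)
  show "regular_shift T (s \<otimes>\<^bsub>T\<^esub> t) n = regular_shift T s (regular_shift T t n)"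
    if "s \<in> carrier T" "t \<in> carrier T" for s t n
    using that by (auto simp: regular_shift_def fun_eq_iff T.inv_mult_group T.m_assoc)
qed

lemma carrier_W: "carrier W = carrier N \<times> carrier T"
  by (simp add: restricted_wreath_product_def semidirect_product_def)

lemma one_W: "\<one>\<^bsub>W\<^esub> = (one\<^sub>N, \<one>\<^bsub>T\<^esub>)"
  by (simp add: restricted_wreath_product_def semidirect_product_def)

lemma mult_W: "(f, s) \<otimes>\<^bsub>W\<^esub> (g, t) = (\<lambda>u\<in>carrier T. f u \<otimes>\<^bsub>G\<^esub> regular_shift T s g u, s \<otimes>\<^bsub>T\<^esub> t)"
  by (simp add: restricted_wreath_product_def semidirect_product_def)

lemma base_closed: "u \<in> carrier T \<Longrightarrow> x \<in> carrier G \<Longrightarrow> base u x \<in> carrier N"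
  by (auto simp: carrier_N coord_def intro: finite_subset[of _ "{u}"])

lemma shift_base:
  assumes "t \<in> carrier T" shows "regular_shift T t (base \<one>\<^bsub>T\<^esub> x) = base t x"
proof -
  have "inv\<^bsub>T\<^esub> t \<otimes>\<^bsub>T\<^esub> u = \<one>\<^bsub>T\<^esub> \<longleftrightarrow> u = t" if "u \<in> carrier T" for u
    using that assms by (metis T.inv_closed T.inv_equality T.inv_inv T.l_inv)
  then show ?thesis using assms by (auto simp: regular_shift_def coord_def fun_eq_iff)
qed

text \<open>Conjugation by \<open>t\<close> moves the factor at \<open>\<one>\<close> to the factor
  at \<open>t\<close>, so \<open>G\<close> at a single coordinate and \<open>T\<close> generate
  everything, even as a monoid. Finite generation and locality of the action are thereby reduced to
  these two kinds of elements.\<close>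

lemma wreath_induct:
  assumes mult: "\<And>a b. a \<in> K \<Longrightarrow> b \<in> K \<Longrightarrow> a \<otimes>\<^bsub>W\<^esub> b \<in> K"
    and base: "\<And>x. x \<in> carrier G \<Longrightarrow> (base \<one>\<^bsub>T\<^esub> x, \<one>\<^bsub>T\<^esub>) \<in> K"
    and top: "\<And>t. t \<in> carrier T \<Longrightarrow> (one\<^sub>N, t) \<in> K"
    and w: "w \<in> carrier W"
  shows "w \<in> K"
proof -
  have *: "(base t x, \<one>\<^bsub>T\<^esub>) \<in> K" if t: "t \<in> carrier T" and x: "x \<in> carrier G" for t x
  proof -
    have "(one\<^sub>N, t) \<otimes>\<^bsub>W\<^esub> (base \<one>\<^bsub>T\<^esub> x, \<one>\<^bsub>T\<^esub>) = (base t x, t)"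
      using t x by (simp add: mult_W shift_base) (auto simp: coord_def fun_eq_iff)
    moreover have "(base t x, t) \<otimes>\<^bsub>W\<^esub> (one\<^sub>N, inv\<^bsub>T\<^esub> t) = (base t x, \<one>\<^bsub>T\<^esub>)"
      using t x by (auto simp: mult_W regular_shift_def coord_def fun_eq_iff)
    ultimately show ?thesis using mult base[OF x] top t T.inv_closed by metis
  qed
  have "f \<in> {f. (f, \<one>\<^bsub>T\<^esub>) \<in> K \<and> f \<in> carrier N}" if f: "f \<in> carrier N" for f
  proof (rule finite_support_induct[where I = "carrier T" and G = "\<lambda>_. G"])
    fix a b assume ab: "a \<in> {f. (f, \<one>\<^bsub>T\<^esub>) \<in> K \<and> f \<in> carrier N}" "b \<in> {f. (f, \<one>\<^bsub>T\<^esub>) \<in> K \<and> f \<in> carrier N}"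
    have "(a, \<one>\<^bsub>T\<^esub>) \<otimes>\<^bsub>W\<^esub> (b, \<one>\<^bsub>T\<^esub>) = (\<lambda>u\<in>carrier T. a u \<otimes>\<^bsub>G\<^esub> b u, \<one>\<^bsub>T\<^esub>)"
      by (auto simp: mult_W regular_shift_def fun_eq_iff)
    moreover have "(\<lambda>u\<in>carrier T. a u \<otimes>\<^bsub>G\<^esub> b u) \<in> carrier N"
      using monoid.m_closed[OF group.is_monoid[OF N_group], of a b] ab by simp
    ultimately show "(\<lambda>u\<in>carrier T. a u \<otimes>\<^bsub>G\<^esub> b u) \<in> {f. (f, \<one>\<^bsub>T\<^esub>) \<in> K \<and> f \<in> carrier N}"
      using mult[of "(a, \<one>\<^bsub>T\<^esub>)" "(b, \<one>\<^bsub>T\<^esub>)"] ab by simp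
  qed (use f * base_closed one_N top[of "\<one>\<^bsub>T\<^esub>"] G.is_group in \<open>auto simp: carrier_N\<close>)
  moreover obtain f t where ft: "w = (f, t)" "f \<in> carrier N" "t \<in> carrier T" using w by (auto simp: carrier_W)
  moreover have "(f, \<one>\<^bsub>T\<^esub>) \<otimes>\<^bsub>W\<^esub> (one\<^sub>N, t) = (f, t)"
    using ft by (auto simp: mult_W regular_shift_def fun_eq_iff carrier_N PiE_def Pi_iff extensional_def)
  ultimately show ?thesis using mult[of "(f, \<one>\<^bsub>T\<^esub>)" "(one\<^sub>N, t)"] top by auto
qed

lemma finitely_generated_W:
  assumes "finitely_generated G" "finitely_generated T"
  shows "finitely_generated W"
proof -
  interpret W: group W by (rule W_group)
  obtain S where S: "finite S" "S \<subseteq> carrier G" "generate G S = carrier G"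
    using assms(1) unfolding finitely_generated_def by blast
  obtain R where R: "finite R" "R \<subseteq> carrier T" "generate T R = carrier T"
    using assms(2) unfolding finitely_generated_def by blast
  let ?e = "\<lambda>x. (base \<one>\<^bsub>T\<^esub> x, \<one>\<^bsub>T\<^esub>)" and ?d = "\<lambda>t. (one\<^sub>N, t)"
  have e: "?e \<in> hom G W"
    by (auto simp: hom_def carrier_W base_closed mult_W) (auto simp: regular_shift_def coord_def fun_eq_iff)
  have d: "?d \<in> hom T W"
    by (auto simp: hom_def carrier_W one_N mult_W regular_shift_def fun_eq_iff)
  show ?thesis
  proof (rule finitely_generatedI[OF W_group, of "?e ` S \<union> ?d ` R"])
    show "?e ` S \<union> ?d ` R \<subseteq> carrier W" using S R e d unfolding hom_def by blast
    show "carrier W \<subseteq> generate W (?e ` S \<union> ?d ` R)"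
    proof
      fix w assume w: "w \<in> carrier W"
      show "w \<in> generate W (?e ` S \<union> ?d ` R)"
      proof (rule wreath_induct[OF _ _ _ w])
        show "?e x \<in> generate W (?e ` S \<union> ?d ` R)" if "x \<in> carrier G" for x
          by (rule hom_generate_subset[OF G.is_group W_group e S(2)]) (use S that in auto)
        show "?d x \<in> generate W (?e ` S \<union> ?d ` R)" if "x \<in> carrier T" for x
          by (rule hom_generate_subset[OF T.is_group W_group d R(2)]) (use R that in auto)
      qed (rule generate.eng)
    qed
  qed (use S R in auto)
qed

text \<open>By \<open>disj\<close> the translates of copy \<open>q\<close> are pairwise disjoint, so
  the coordinate \<open>f u\<close> can act on the translate by \<open>u\<close> through the
  conjugate of the given action of \<open>G\<close>, independently of all other coordinates.\<close>

lemma fg_subgroup_of_V_W: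
  assumes V: "fg_subgroup_of_V G" and T: "finitely_generated T"
    and Q: "finite Q" "q \<in> Q" and act: "cantor_action T Q \<alpha>"
    and disj: "\<And>t z z'. t \<in> carrier T \<Longrightarrow> \<alpha> t (q, z) = (q, z') \<Longrightarrow> t = \<one>\<^bsub>T\<^esub>"
  shows "fg_subgroup_of_V W"
proof -
  obtain h where h: "h \<in> mon G thompson_V" and fgG: "finitely_generated G"
    using V unfolding fg_subgroup_of_V_def by blast
  note \<rho> = mon_thompson_VD[OF G.is_group h]
  note \<alpha> = cantor_actionD[OF act]
  have inQ: "(q, z) \<in> Q \<times> UNIV" for z :: "bool stream" using Q by simp
  have cancel: "\<alpha> (inv\<^bsub>T\<^esub> u) (\<alpha> u p) = p" if "u \<in> carrier T" "p \<in> Q \<times> UNIV" for u p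
    using that \<alpha>(1) by (simp flip: \<alpha>(2))
  have uniq: "u = v \<and> z = y" if "u \<in> carrier T" "v \<in> carrier T" "\<alpha> u (q, z) = \<alpha> v (q, y)" for u v z y
  proof -
    have "\<alpha> (inv\<^bsub>T\<^esub> v \<otimes>\<^bsub>T\<^esub> u) (q, z) = \<alpha> (inv\<^bsub>T\<^esub> v) (\<alpha> u (q, z))"
      using that(1,2) by (intro \<alpha>(2) inQ) simp_all
    also have "\<dots> = (q, y)" using cancel[OF that(2) inQ] that(3) by simp
    finally have "\<alpha> (inv\<^bsub>T\<^esub> v \<otimes>\<^bsub>T\<^esub> u) (q, z) = (q, y)" .
    then have "inv\<^bsub>T\<^esub> v \<otimes>\<^bsub>T\<^esub> u = \<one>\<^bsub>T\<^esub>" using disj[of "inv\<^bsub>T\<^esub> v \<otimes>\<^bsub>T\<^esub> u" z y] that by simp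
    then have "u = v" using that by (metis T.inv_closed T.inv_equality T.inv_inv)
    moreover have "(q, z) = (q, y)" using cancel[OF that(2) inQ] that(3) \<open>u = v\<close> by metis
    ultimately show ?thesis by simp
  qed
  define orb where "orb = {\<alpha> u (q, z) | u z. u \<in> carrier T}"
  \<comment> \<open>By \<open>uniq\<close> the choice has only one candidate; points outside all
    translates stay fixed.\<close>
  define \<beta> where "\<beta> f p = (if p \<in> orb then SOME p'. \<exists>u\<in>carrier T. \<exists>z. p = \<alpha> u (q, z) \<and> p' = \<alpha> u (q, h (f u) z) else p)" for f p
  have \<beta>_orb: "\<beta> f (\<alpha> u (q, z)) = \<alpha> u (q, h (f u) z)" if u: "u \<in> carrier T" for f u z
  proof -
    have "(\<exists>v\<in>carrier T. \<exists>y. \<alpha> u (q, z) = \<alpha> v (q, y) \<and> p' = \<alpha> v (q, h (f v) y)) \<longleftrightarrow> p' = \<alpha> u (q, h (f u) z)" for p'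
      using uniq u by metis
    moreover have "\<alpha> u (q, z) \<in> orb" using u by (auto simp: orb_def)
    ultimately show ?thesis by (simp add: \<beta>_def)
  qed
  have orb_closed: "\<alpha> s p \<in> orb" if s: "s \<in> carrier T" and p: "p \<in> orb" for s p
  proof -
    obtain u z where "u \<in> carrier T" "p = \<alpha> u (q, z)" using p by (auto simp: orb_def)
    then have "\<alpha> s p = \<alpha> (s \<otimes>\<^bsub>T\<^esub> u) (q, z)" using s inQ by (simp add: \<alpha>(2))
    then show ?thesis using s \<open>u \<in> carrier T\<close> unfolding orb_def by blast
  qed
  define \<Phi> where "\<Phi> = (\<lambda>(f, t) p. \<beta> f (\<alpha> t p))"
  have \<Phi>_mult: "\<Phi> (a \<otimes>\<^bsub>W\<^esub> b) p = \<Phi> a (\<Phi> b p)"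
    if a: "a \<in> carrier W" and b: "b \<in> carrier W" and p: "p \<in> Q \<times> UNIV" for a b p
  proof -
    obtain f s where f: "a = (f, s)" "f \<in> carrier N" "s \<in> carrier T" using a by (auto simp: carrier_W)
    obtain g t where g: "b = (g, t)" "g \<in> carrier N" "t \<in> carrier T" using b by (auto simp: carrier_W)
    have fg: "f u \<in> carrier G" "g u \<in> carrier G" if "u \<in> carrier T" for u
      using f(2) g(2) that by (auto simp: carrier_N)
    show ?thesis
    proof (cases "\<alpha> t p \<in> orb")
      case True
      then obtain u z where u: "u \<in> carrier T" "\<alpha> t p = \<alpha> u (q, z)" by (auto simp: orb_def)
      have su: "inv\<^bsub>T\<^esub> s \<otimes>\<^bsub>T\<^esub> (s \<otimes>\<^bsub>T\<^esub> u) = u" using f u by (simp flip: T.m_assoc)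
      have "\<alpha> (s \<otimes>\<^bsub>T\<^esub> t) p = \<alpha> (s \<otimes>\<^bsub>T\<^esub> u) (q, z)"
        using f g u p inQ by (simp add: \<alpha>(2))
      moreover have "\<alpha> s (\<alpha> u (q, y)) = \<alpha> (s \<otimes>\<^bsub>T\<^esub> u) (q, y)" for y
        using f u inQ by (simp add: \<alpha>(2))
      ultimately show ?thesis
        using f g u fg su by (simp add: \<Phi>_def mult_W \<beta>_orb \<rho>(2) regular_shift_def)
    next
      case False
      have "\<alpha> s (\<alpha> t p) \<notin> orb"
        using orb_closed[of "inv\<^bsub>T\<^esub> s" "\<alpha> s (\<alpha> t p)"] f g p False by (auto simp: cancel \<alpha>(4))
      then show ?thesis using f g p False by (simp add: \<Phi>_def mult_W \<beta>_def \<alpha>(2))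
    qed
  qed
  have \<beta>_one: "\<beta> one\<^sub>N p = p" for p
  proof (cases "p \<in> orb")
    case True
    then obtain u z where "u \<in> carrier T" "p = \<alpha> u (q, z)" by (auto simp: orb_def)
    then show ?thesis by (simp add: \<beta>_orb \<rho>(1))
  qed (simp add: \<beta>_def)
  \<comment> \<open>Copy \<open>q\<close> is the translate by \<open>\<one>\<close> and meets no
    other translate, so an element supported at \<open>\<one>\<close> acts on copy \<open>q\<close>
    and nowhere else.\<close>
  have \<Phi>_base: "\<Phi> (base \<one>\<^bsub>T\<^esub> x, \<one>\<^bsub>T\<^esub>) (i, z) = (i, (if i = q then h x else (\<lambda>z. z)) z)"
    if x: "x \<in> carrier G" and i: "i \<in> Q" for x i z
  proof (cases "(i, z) \<in> orb")
    case True
    then obtain u y where u: "u \<in> carrier T" "(i, z) = \<alpha> u (q, y)" by (auto simp: orb_def)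
    show ?thesis
    proof (cases "u = \<one>\<^bsub>T\<^esub>")
      case True
      then have "(i, z) = (q, y)" using u \<alpha>(1) inQ by simp
      then show ?thesis using \<beta>_orb[of "\<one>\<^bsub>T\<^esub>" "base \<one>\<^bsub>T\<^esub> x" y] \<alpha>(1) inQ
        by (simp add: \<Phi>_def coord_def)
    next
      case False
      then have "i \<noteq> q" using disj[OF u(1), of y z] u(2) by auto
      moreover have "\<beta> (base \<one>\<^bsub>T\<^esub> x) (i, z) = (i, z)"
        using \<beta>_orb[OF u(1), of "base \<one>\<^bsub>T\<^esub> x" y] u(1) False unfolding u(2) by (simp add: coord_def \<rho>(1))
      ultimately show ?thesis using i \<alpha>(1)[of "(i, z)"] by (simp add: \<Phi>_def)
    qed
  next
    case False
    have "i \<noteq> q"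
    proof
      assume "i = q"
      then have "(i, z) = \<alpha> \<one>\<^bsub>T\<^esub> (q, z)" using \<alpha>(1) inQ by simp
      then show False using False unfolding orb_def by blast
    qed
    then show ?thesis using False i \<alpha>(1)[of "(i, z)"] by (simp add: \<Phi>_def \<beta>_def)
  qed
  \<comment> \<open>The translates may be infinite in number, and locality of
    \<open>\<beta> f\<close> is not visible from its definition; it is inherited from generators
    through \<open>local_on_comp\<close>.\<close>
  have "w \<in> {w \<in> carrier W. local_on Q (\<Phi> w)}" if w: "w \<in> carrier W" for w
  proof (rule wreath_induct[OF _ _ _ w])
    fix a b assume "a \<in> {w \<in> carrier W. local_on Q (\<Phi> w)}" "b \<in> {w \<in> carrier W. local_on Q (\<Phi> w)}"
    then show "a \<otimes>\<^bsub>W\<^esub> b \<in> {w \<in> carrier W. local_on Q (\<Phi> w)}"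
      using local_on_comp[of Q "\<Phi> b" "\<Phi> a" "\<Phi> (a \<otimes>\<^bsub>W\<^esub> b)"] \<Phi>_mult monoid.m_closed[OF group.is_monoid[OF W_group]]
      by blast
  next
    fix x assume x: "x \<in> carrier G"
    have "prefix_local (\<lambda>z. z)" using \<rho>(1) \<rho>(3)[of "\<one>\<^bsub>G\<^esub>"] by (simp add: id_def)
    then have "local_on Q (\<Phi> (base \<one>\<^bsub>T\<^esub> x, \<one>\<^bsub>T\<^esub>))"
      using \<Phi>_base[OF x] \<rho>(3)[OF x]
      by (intro local_on_second[where j = "\<lambda>i. i" and \<rho> = "\<lambda>i. if i = q then h x else (\<lambda>z. z)"]) auto
    then show "(base \<one>\<^bsub>T\<^esub> x, \<one>\<^bsub>T\<^esub>) \<in> {w \<in> carrier W. local_on Q (\<Phi> w)}"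
      using x by (simp add: carrier_W base_closed)
  next
    fix t assume t: "t \<in> carrier T"
    have "\<Phi> (one\<^sub>N, t) = \<alpha> t" by (simp add: \<Phi>_def \<beta>_one fun_eq_iff)
    then show "(one\<^sub>N, t) \<in> {w \<in> carrier W. local_on Q (\<Phi> w)}"
      using t \<alpha>(3) by (simp add: carrier_W one_N)
  qed
  then have actW: "cantor_action W Q \<Phi>"
    unfolding cantor_action_def using \<Phi>_mult \<alpha>(1) by (auto simp: one_W \<Phi>_def \<beta>_one)
  show ?thesis
  proof (rule fg_subgroup_of_VI[OF W_group finitely_generated_W[OF fgG T] Q(1) _ actW])
    fix w assume w: "w \<in> carrier W" and triv: "\<And>p. p \<in> Q \<times> UNIV \<Longrightarrow> \<Phi> w p = p"
    obtain f t where ft: "w = (f, t)" "f \<in> carrier N" "t \<in> carrier T" using w by (auto simp: carrier_W)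
    have t: "t = \<one>\<^bsub>T\<^esub>"
    proof -
      fix z
      have "\<alpha> t (q, h (f t) z) = (q, z)" using triv[OF inQ, of z] ft by (simp add: \<Phi>_def \<beta>_orb)
      then show ?thesis using disj ft by blast
    qed
    have "f u = \<one>\<^bsub>G\<^esub>" if u: "u \<in> carrier T" for u
    proof (rule \<rho>(4))
      show "f u \<in> carrier G" using ft u by (auto simp: carrier_N)
      fix z
      have p: "\<alpha> u (q, z) \<in> Q \<times> UNIV" using \<alpha>(4)[OF u inQ] .
      have "\<alpha> u (q, h (f u) z) = \<alpha> u (q, z)"
        using triv[OF p] ft t u \<alpha>(1)[OF p] by (simp add: \<Phi>_def \<beta>_orb)
      then show "h (f u) z = z" using uniq u by blast
    qed
    then have "f = one\<^sub>N" using ft(2) by (auto simp: carrier_N fun_eq_iff PiE_def extensional_def)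
    then show "w = \<one>\<^bsub>W\<^esub>" using ft t by (simp add: one_W)
  qed (use Q in auto)
qed

end

section \<open>Actions from trees of cones\<close>

text \<open>An edge \<open>(R, k, S)\<close> says that the translate of \<open>S\<close> by \<open>k\<close> is a child of the cone \<open>R\<close> with frontier
  \<open>F R\<close>. A generator moves a frontier point within the frontier, into that of a child, or into that of
  every possible parent.\<close>

locale cone_tree = group G for G (structure) +
  fixes \<Sigma> :: "'a set" and types :: "'a set set" and F :: "'a set \<Rightarrow> 'a set"
    and edges :: "('a set \<times> 'a \<times> 'a set) set" and root :: "'a set"
  assumes gen: "\<Sigma> \<subseteq> carrier G" "generate G \<Sigma> = carrier G" "\<And>s. s \<in> \<Sigma> \<Longrightarrow> inv s \<in> \<Sigma>"
    and fin: "finite types" "\<And>R. R \<in> types \<Longrightarrow> finite (F R)" "finite edges"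
    and types_carrier: "\<And>R. R \<in> types \<Longrightarrow> R \<subseteq> carrier G"
    and F_subset: "\<And>R. R \<in> types \<Longrightarrow> F R \<subseteq> R"
    and edges: "\<And>R k S. (R, k, S) \<in> edges \<Longrightarrow> R \<in> types \<and> k \<in> carrier G \<and> S \<in> types"
    and edge_inside: "\<And>R k S x. (R, k, S) \<in> edges \<Longrightarrow> x \<in> S \<Longrightarrow> x \<otimes> k \<in> R - F R"
    and edge_disjoint: "\<And>R k S k' S' x x'. (R, k, S) \<in> edges \<Longrightarrow> (R, k', S') \<in> edges \<Longrightarrow>
      x \<in> S \<Longrightarrow> x' \<in> S' \<Longrightarrow> x \<otimes> k = x' \<otimes> k' \<Longrightarrow> k = k' \<and> S = S'"
    and move: "\<And>s R f. s \<in> \<Sigma> \<Longrightarrow> R \<in> types \<Longrightarrow> f \<in> F R \<Longrightarrow>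
      s \<otimes> f \<in> F R \<or> (\<exists>k S. (R, k, S) \<in> edges \<and> s \<otimes> f \<otimes> inv k \<in> F S) \<or>
      (\<exists>S k. (S, k, R) \<in> edges) \<and> (\<forall>S k. (S, k, R) \<in> edges \<longrightarrow> s \<otimes> f \<otimes> k \<in> F S)"
    and root: "root \<in> types" "\<one> \<in> F root" "\<And>S k. (S, k, root) \<notin> edges"
begin

definition parents :: "'a set \<Rightarrow> ('a set \<times> 'a) set" where
  "parents R = {(S, k). (S, k, R) \<in> edges}"

lemma finite_parents: "finite (parents R)"
proof -
  have "parents R \<subseteq> (\<lambda>(S, k, _). (S, k)) ` edges" by (force simp: parents_def)
  then show ?thesis using fin(3) finite_surj by blast
qed

primrec chain :: "('a set \<times> 'a) list \<Rightarrow> 'a set \<Rightarrow> 'a set \<Rightarrow> bool" where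
  "chain [] R S \<longleftrightarrow> R \<in> types \<and> R = S"
| "chain (p # ps) R S \<longleftrightarrow> p \<in> parents R \<and> chain ps (fst p) S"

text \<open>Right multiplication by the offset puts the innermost cone type into its place inside
  the outermost one.\<close>

primrec offset :: "('a set \<times> 'a) list \<Rightarrow> 'a" where
  "offset [] = \<one>"
| "offset (p # ps) = snd p \<otimes> offset ps"

lemma parents_types: "p \<in> parents R \<Longrightarrow> R \<in> types \<and> fst p \<in> types \<and> snd p \<in> carrier G"
  using edges by (force simp: parents_def)

lemma chain_types: "chain ps R S \<Longrightarrow> R \<in> types \<and> S \<in> types"
  by (induction ps arbitrary: R) (auto dest: parents_types)

lemma chain_append: "chain (ps @ qs) R S \<longleftrightarrow> (\<exists>U. chain ps R U \<and> chain qs U S)"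
  by (induction ps arbitrary: R) (auto dest: chain_types)

lemma offset_closed: "chain ps R S \<Longrightarrow> offset ps \<in> carrier G"
  by (induction ps arbitrary: R) (auto dest: parents_types)

lemma offset_append: "chain ps R S \<Longrightarrow> chain qs S U \<Longrightarrow> offset (ps @ qs) = offset ps \<otimes> offset qs"
proof (induction ps arbitrary: R)
  case (Cons p ps)
  then have "snd p \<in> carrier G" "offset ps \<in> carrier G" "offset qs \<in> carrier G"
    using parents_types[of p R] offset_closed[of ps "fst p" S] offset_closed[of qs S U] by simp_all
  then show ?case using Cons.IH[of "fst p"] Cons.prems by (simp add: m_assoc)
qed (use offset_closed in auto)

lemma F_carrier: "R \<in> types \<Longrightarrow> f \<in> F R \<Longrightarrow> f \<in> carrier G"
  using types_carrier F_subset by blast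

lemma chain_inside: "chain ps R S \<Longrightarrow> x \<in> R \<Longrightarrow> x \<otimes> offset ps \<in> S"
proof (induction ps arbitrary: R x)
  case Nil
  then have "x \<in> carrier G" using types_carrier by auto
  then show ?case using Nil by simp
next
  case (Cons p ps)
  then have "(fst p, snd p, R) \<in> edges" by (simp add: parents_def split: prod.splits)
  then have "x \<otimes> snd p \<in> fst p" using edge_inside Cons.prems(2) by blast
  then have "x \<otimes> snd p \<otimes> offset ps \<in> S" using Cons.IH[of "fst p"] Cons.prems by simp
  moreover have "x \<in> carrier G" "snd p \<in> carrier G" "offset ps \<in> carrier G"
    using Cons.prems parents_types[of p R] offset_closed[of ps "fst p" S] types_carrier by auto
  ultimately show ?case by (simp add: m_assoc)
qed

lemma chain_snoc_edge:
  assumes "chain (ps @ [p]) R S" "f \<in> F R"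
  obtains U where "chain ps R U" "(S, snd p, U) \<in> edges" "f \<otimes> offset ps \<in> U"
    "f \<otimes> offset (ps @ [p]) = f \<otimes> offset ps \<otimes> snd p"
proof -
  obtain U where U: "chain ps R U" "chain [p] U S" using assms(1) chain_append by blast
  have "(S, snd p, U) \<in> edges" using U(2) by (auto simp: parents_def split: prod.splits)
  moreover have "f \<in> R" using assms(2) F_subset chain_types[OF assms(1)] by blast
  moreover have "f \<otimes> offset (ps @ [p]) = f \<otimes> offset ps \<otimes> snd p"
    using offset_append[OF U] offset_closed[OF U(1)] F_carrier[OF _ assms(2)] chain_types[OF assms(1)]
      parents_types[of p U] U(2) by (simp add: m_assoc)
  ultimately show ?thesis using that U(1) chain_inside by blast
qed

text \<open>The outermost edge of the chain is recovered by comparing the point with the frontier of \<open>S\<close> and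
  the disjoint child cones.\<close>

lemma chain_unique:
  assumes "chain ps R S" "chain ps' R' S" "f \<in> F R" "f' \<in> F R'" "f \<otimes> offset ps = f' \<otimes> offset ps'"
  shows "ps = ps' \<and> R = R' \<and> f = f'"
  using assms
proof (induction ps arbitrary: ps' S rule: rev_induct)
  case Nil
  have f: "f \<in> F S" "f \<otimes> offset [] = f" using Nil F_carrier by auto
  show ?case
  proof (cases ps' rule: rev_cases)
    case Nil
    then have "f \<in> carrier G" "f' \<in> carrier G" using Nil.prems F_carrier by auto
    then show ?thesis using Nil.prems Nil by simp
  next
    case (snoc qs q)
    obtain U where "(S, snd q, U) \<in> edges" "f' \<otimes> offset qs \<in> U" "f' \<otimes> offset ps' = f' \<otimes> offset qs \<otimes> snd q"
      using chain_snoc_edge[OF _ Nil.prems(4)] Nil.prems(2) snoc by metis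
    then have "f' \<otimes> offset ps' \<notin> F S" using edge_inside by auto
    then show ?thesis using f Nil.prems(5) by simp
  qed
next
  case (snoc p ps)
  obtain U where U: "chain ps R U" "(S, snd p, U) \<in> edges" "f \<otimes> offset ps \<in> U"
    "f \<otimes> offset (ps @ [p]) = f \<otimes> offset ps \<otimes> snd p"
    using chain_snoc_edge[OF snoc.prems(1,3)] by metis
  show ?case
  proof (cases ps' rule: rev_cases)
    case Nil
    then have "f' \<in> carrier G" "R' = S" using snoc.prems F_carrier by auto
    then have "f \<otimes> offset (ps @ [p]) \<in> F S" using snoc.prems Nil by simp
    then show ?thesis using edge_inside[OF U(2,3)] U(4) by simp
  next
    case (snoc qs q)
    obtain U' where U': "chain qs R' U'" "(S, snd q, U') \<in> edges" "f' \<otimes> offset qs \<in> U'"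
      "f' \<otimes> offset (qs @ [q]) = f' \<otimes> offset qs \<otimes> snd q"
      using chain_snoc_edge[OF _ snoc.prems(4)] snoc.prems(2) snoc by metis
    have eq: "f \<otimes> offset ps \<otimes> snd p = f' \<otimes> offset qs \<otimes> snd q" using U U' snoc.prems(5) snoc by simp
    then have same: "snd p = snd q" "U = U'" using edge_disjoint[OF U(2) U'(2) U(3) U'(3)] by auto
    have "f \<otimes> offset ps \<in> carrier G" "f' \<otimes> offset qs \<in> carrier G" "snd q \<in> carrier G"
      using U U' edges[OF U(2)] edges[OF U'(2)] types_carrier by blast+
    then have "f \<otimes> offset ps = f' \<otimes> offset qs" using eq same by simp
    then have "ps = qs \<and> R = R' \<and> f = f'" using snoc.IH[OF U(1) _ snoc.prems(3,4)] U'(1) same by blast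
    moreover have "fst p = S" "fst q = S" using snoc.prems(1,2) snoc by (auto simp: chain_append)
    ultimately show ?thesis using same snoc by (simp add: prod_eq_iff)
  qed
qed

end

section \<open>Coding positions in the tree by streams\<close>

locale coded_cone_tree = cone_tree +
  fixes b :: "'a set \<Rightarrow> 'a set \<times> 'a \<Rightarrow> bool list"
  assumes code_bij: "\<And>R. parents R \<noteq> {} \<Longrightarrow>
    bij_betw (\<lambda>(p, y). b R p @- y) (parents R \<times> UNIV) (UNIV :: bool stream set)"
begin

primrec code :: "('a set \<times> 'a) list \<Rightarrow> 'a set \<Rightarrow> bool list" where
  "code [] R = []"
| "code (p # ps) R = b R p @ code ps (fst p)"

lemma code_append: "chain ps R S \<Longrightarrow> code (ps @ qs) R = code ps R @ code qs S"
  by (induction ps arbitrary: R) auto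

lemma b_inj:
  assumes "p \<in> parents R" "q \<in> parents R" "b R p @- y = b R q @- z"
  shows "p = q \<and> y = z"
proof -
  have "parents R \<noteq> {}" using assms(1) by blast
  from inj_onD[OF bij_betw_imp_inj_on[OF code_bij[OF this]], of "(p, y)" "(q, z)"] show ?thesis
    using assms by simp
qed

lemma b_surj:
  assumes "parents R \<noteq> {}" obtains p y where "p \<in> parents R" "z = b R p @- y"
proof -
  have "z \<in> (\<lambda>(p, y). b R p @- y) ` (parents R \<times> UNIV)"
    using code_bij[OF assms] unfolding bij_betw_def by simp
  then show ?thesis using that by auto
qed

text \<open>Decoding is deterministic: the current type selects the prefix code that reads the next
  parent. Two chains read from the same stream therefore agree until one of them ends.\<close>

lemma chain_compare:
  assumes "chain ps R S" "chain qs R U" "code ps R @- y = code qs R @- z"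
  shows "(\<exists>rs. qs = ps @ rs \<and> chain rs S U \<and> y = code rs S @- z) \<or>
    (\<exists>rs. ps = qs @ rs \<and> chain rs U S \<and> z = code rs U @- y)"
  using assms
proof (induction ps arbitrary: R qs)
  case Nil
  then show ?case by auto
next
  case (Cons p ps)
  show ?case
  proof (cases qs)
    case Nil
    then show ?thesis using Cons.prems by auto
  next
    case (Cons q qs')
    then have "p = q \<and> code ps (fst p) @- y = code qs' (fst q) @- z"
      using Cons.prems b_inj[of p R q] by simp
    then show ?thesis using Cons.IH[of "fst p" qs'] Cons.prems Cons by auto
  qed
qed

text \<open>A state \<open>(R, f)\<close> with a stack whose chain \<open>ps\<close> ends in a cone of type \<open>S\<close> denotes the element
  \<open>f \<otimes> offset ps\<close> of \<open>S\<close>. Whatever lies deeper in the stack is not touched.\<close>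

definition rel :: "'a \<Rightarrow> ('a set \<times> 'a) \<times> bool stream \<Rightarrow> ('a set \<times> 'a) \<times> bool stream \<Rightarrow> bool" where
  "rel t x x' \<longleftrightarrow> (\<exists>R f ps R' f' ps' S y.
     x = ((R, f), code ps R @- y) \<and> x' = ((R', f'), code ps' R' @- y) \<and>
     f \<in> F R \<and> f' \<in> F R' \<and> chain ps R S \<and> chain ps' R' S \<and>
     f' \<otimes> offset ps' = t \<otimes> (f \<otimes> offset ps))"

lemma relI:
  assumes "f \<in> F R" "f' \<in> F R'" "chain ps R S" "chain ps' R' S" "f' \<otimes> offset ps' = t \<otimes> (f \<otimes> offset ps)"
  shows "rel t ((R, f), code ps R @- y) ((R', f'), code ps' R' @- y)"
  using assms unfolding rel_def by blast

abbreviation "states \<equiv> Sigma types F"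

lemma rel_refl: "x \<in> states \<times> UNIV \<Longrightarrow> rel \<one> x x"
proof -
  assume "x \<in> states \<times> UNIV"
  then obtain R f y where "x = ((R, f), y)" "R \<in> types" "f \<in> F R" by auto
  then show ?thesis using relI[of f R f R "[]" R "[]" \<one> y] F_carrier by simp
qed

lemma rel_states: "rel t x x' \<Longrightarrow> x \<in> states \<times> UNIV \<and> x' \<in> states \<times> UNIV"
  unfolding rel_def using chain_types by auto

lemma rel_inv:
  assumes "t \<in> carrier G" "rel t x x'" shows "rel (inv t) x' x"
proof -
  obtain R f ps R' f' ps' S y where *: "x = ((R, f), code ps R @- y)" "x' = ((R', f'), code ps' R' @- y)"
     "f \<in> F R" "f' \<in> F R'" "chain ps R S" "chain ps' R' S" "f' \<otimes> offset ps' = t \<otimes> (f \<otimes> offset ps)"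
    using assms(2) unfolding rel_def by blast
  have "f \<in> carrier G" "offset ps \<in> carrier G"
    using * F_carrier offset_closed chain_types by blast+
  then have "f \<otimes> offset ps = inv t \<otimes> (f' \<otimes> offset ps')"
    using assms(1) *(7) by (simp add: m_assoc[symmetric])
  then show ?thesis unfolding rel_def using * by blast
qed

text \<open>The two witnesses may look at the ancestors to different depths. By
  \<open>chain_compare\<close> they differ by a chain \<open>rs\<close>, which is appended to the
  shallower witness on both sides and multiplies both of its elements by
  \<open>offset rs\<close>.\<close>

lemma rel_comp:
  assumes "t \<in> carrier G" "u \<in> carrier G" "rel t x x'" "rel u x' x''" shows "rel (u \<otimes> t) x x''"
proof -
  obtain R f ps R' f' ps' S y where 1: "x = ((R, f), code ps R @- y)" "x' = ((R', f'), code ps' R' @- y)"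
     "f \<in> F R" "f' \<in> F R'" "chain ps R S" "chain ps' R' S" "f' \<otimes> offset ps' = t \<otimes> (f \<otimes> offset ps)"
    using assms(3) unfolding rel_def by blast
  obtain qs R'' f'' qs' U z where 2: "x' = ((R', f'), code qs R' @- z)" "x'' = ((R'', f''), code qs' R'' @- z)"
     "f'' \<in> F R''" "chain qs R' U" "chain qs' R'' U" "f'' \<otimes> offset qs' = u \<otimes> (f' \<otimes> offset qs)"
    using assms(4) 1(2) unfolding rel_def by auto
  have cl: "f \<in> carrier G" "f' \<in> carrier G" "f'' \<in> carrier G" "offset ps \<in> carrier G" "offset ps' \<in> carrier G"
    "offset qs \<in> carrier G" "offset qs' \<in> carrier G"
    using 1 2 F_carrier offset_closed chain_types by blast+
  have "code ps' R' @- y = code qs R' @- z" using 1(2) 2(1) by simp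
  from chain_compare[OF 1(6) 2(4) this] show ?thesis
  proof
    assume "\<exists>rs. qs = ps' @ rs \<and> chain rs S U \<and> y = code rs S @- z"
    then obtain rs where rs: "qs = ps' @ rs" "chain rs S U" "y = code rs S @- z" by blast
    have c: "chain (ps @ rs) R U" using 1 rs chain_append by blast
    have x: "x = ((R, f), code (ps @ rs) R @- z)" using 1 rs by (simp add: code_append)
    have r: "offset rs \<in> carrier G" using rs offset_closed by blast
    have "f'' \<otimes> offset qs' = u \<otimes> (f' \<otimes> (offset ps' \<otimes> offset rs))"
      using 2(6) rs offset_append[OF 1(6) rs(2)] by simp
    also have "\<dots> = u \<otimes> ((f' \<otimes> offset ps') \<otimes> offset rs)" using cl r assms by (simp add: m_assoc)
    also have "\<dots> = u \<otimes> t \<otimes> (f \<otimes> (offset ps \<otimes> offset rs))" using 1(7) cl r assms by (simp add: m_assoc)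
    also have "\<dots> = u \<otimes> t \<otimes> (f \<otimes> offset (ps @ rs))" using offset_append[OF 1(5) rs(2)] by simp
    finally show ?thesis unfolding rel_def using x c 1 2 by blast
  next
    assume "\<exists>rs. ps' = qs @ rs \<and> chain rs U S \<and> z = code rs U @- y"
    then obtain rs where rs: "ps' = qs @ rs" "chain rs U S" "z = code rs U @- y" by blast
    have c: "chain (qs' @ rs) R'' S" using 2 rs chain_append by blast
    have x: "x'' = ((R'', f''), code (qs' @ rs) R'' @- y)" using 2 rs by (simp add: code_append)
    have r: "offset rs \<in> carrier G" using rs offset_closed by blast
    have "f'' \<otimes> offset (qs' @ rs) = f'' \<otimes> offset qs' \<otimes> offset rs"
      using offset_append[OF 2(5) rs(2)] cl r by (simp add: m_assoc)
    also have "\<dots> = u \<otimes> (f' \<otimes> (offset qs \<otimes> offset rs))" using 2(6) cl r assms by (simp add: m_assoc)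
    also have "\<dots> = u \<otimes> (f' \<otimes> offset ps')" using offset_append[OF 2(4) rs(2)] rs by simp
    also have "\<dots> = u \<otimes> t \<otimes> (f \<otimes> offset ps)" using 1(7) cl assms by (simp add: m_assoc)
    finally show ?thesis unfolding rel_def using x c 1 2 by blast
  qed
qed

text \<open>Both points name the same element of one cone \<open>S\<close>, and by
  \<open>chain_unique\<close> such a name is unique. This is what makes the action well
  defined.\<close>

lemma rel_one_eq: assumes "rel \<one> x x'" shows "x = x'"
proof -
  obtain R f ps R' f' ps' S y where *: "x = ((R, f), code ps R @- y)" "x' = ((R', f'), code ps' R' @- y)"
     "f \<in> F R" "f' \<in> F R'" "chain ps R S" "chain ps' R' S" "f' \<otimes> offset ps' = \<one> \<otimes> (f \<otimes> offset ps)"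
    using assms unfolding rel_def by blast
  have "f \<in> carrier G" "offset ps \<in> carrier G"
    using * F_carrier offset_closed chain_types by blast+
  then show ?thesis using chain_unique[OF *(5,6,3,4)] * by simp
qed

lemma rel_unique: "t \<in> carrier G \<Longrightarrow> rel t x x' \<Longrightarrow> rel t x x'' \<Longrightarrow> x' = x''"
  using rel_comp[of "inv t" t x' x x''] rel_inv[of t x x'] rel_one_eq by simp

lemma rel_total_generator:
  assumes s: "s \<in> \<Sigma>" and x: "x \<in> states \<times> UNIV" shows "\<exists>x'. rel s x x'"
proof -
  obtain R f y where x: "x = ((R, f), y)" and R: "R \<in> types" "f \<in> F R" using x by auto
  have cl: "s \<in> carrier G" "f \<in> carrier G" using s gen F_carrier R by auto
  from move[OF s R] show ?thesis
  proof (elim disjE)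
    assume "s \<otimes> f \<in> F R"
    then have "rel s x ((R, s \<otimes> f), y)"
      using relI[of f R "s \<otimes> f" R "[]" R "[]" s y] R cl by (simp add: x)
    then show ?thesis by blast
  next
    assume "\<exists>k S. (R, k, S) \<in> edges \<and> s \<otimes> f \<otimes> inv k \<in> F S"
    then obtain k S where S: "(R, k, S) \<in> edges" "s \<otimes> f \<otimes> inv k \<in> F S" by blast
    have k: "k \<in> carrier G" using S edges by blast
    have "rel s x ((S, s \<otimes> f \<otimes> inv k), code [(R, k)] S @- y)"
      using relI[of f R "s \<otimes> f \<otimes> inv k" S "[]" R "[(R, k)]" s y] R cl k S
      by (simp add: x parents_def m_assoc)
    then show ?thesis by blast
  next
    assume *: "(\<exists>S k. (S, k, R) \<in> edges) \<and> (\<forall>S k. (S, k, R) \<in> edges \<longrightarrow> s \<otimes> f \<otimes> k \<in> F S)"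
    \<comment> \<open>Leaving the cone pops one entry: the stream itself names the parent, and
      \<open>move\<close> was assumed for all parents, so it applies to this one.\<close>
    then have "parents R \<noteq> {}" by (auto simp: parents_def)
    then obtain p z where p: "p \<in> parents R" "y = b R p @- z" using b_surj by blast
    have edge: "(fst p, snd p, R) \<in> edges" using p(1) by (auto simp: parents_def)
    then have k: "snd p \<in> carrier G" "fst p \<in> types" using edges by blast+
    have "s \<otimes> f \<otimes> snd p \<in> F (fst p)" using * edge by blast
    then have "rel s x ((fst p, s \<otimes> f \<otimes> snd p), z)"
      using relI[of f R "s \<otimes> f \<otimes> snd p" "fst p" "[p]" "fst p" "[]" s z] R cl k p
      by (simp add: x m_assoc)
    then show ?thesis by blast
  qed
qed

lemma rel_total:
  assumes "t \<in> carrier G" "x \<in> states \<times> UNIV" shows "\<exists>x'. rel t x x'"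
proof -
  have "t \<in> generate G \<Sigma>" using assms(1) gen by simp
  then show ?thesis using assms(2)
  proof (induction arbitrary: x rule: generate.induct)
    case one
    then show ?case using rel_refl by blast
  next
    case (incl h)
    then show ?case using rel_total_generator by blast
  next
    case (inv h)
    then show ?case using rel_total_generator gen by blast
  next
    case (eng h1 h2)
    obtain x' where "rel h2 x x'" using eng by blast
    moreover obtain x'' where "rel h1 x' x''" using eng rel_states \<open>rel h2 x x'\<close> by blast
    ultimately show ?case using rel_comp[of h2 h1] eng.hyps gen by blast
  qed
qed

definition act :: "'a \<Rightarrow> ('a set \<times> 'a) \<times> bool stream \<Rightarrow> ('a set \<times> 'a) \<times> bool stream" where
  "act t x = (THE x'. rel t x x')"

lemma act_eq: "t \<in> carrier G \<Longrightarrow> rel t x x' \<Longrightarrow> act t x = x'"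
  unfolding act_def using rel_unique by blast

lemma rel_act: "t \<in> carrier G \<Longrightarrow> x \<in> states \<times> UNIV \<Longrightarrow> rel t x (act t x)"
  using rel_total act_eq by metis

lemma cantor_action_act: "cantor_action G states act"
  unfolding cantor_action_def
proof (intro conjI ballI)
  show "act \<one> p = p" if "p \<in> states \<times> UNIV" for p
    using act_eq rel_refl that by blast
  show "act (g \<otimes> h) p = act g (act h p)" if "g \<in> carrier G" "h \<in> carrier G" "p \<in> states \<times> UNIV" for g h p
  proof (rule act_eq)
    have h: "rel h p (act h p)" using rel_act that by blast
    then have "rel g (act h p) (act g (act h p))" using rel_act rel_states that(1) by blast
    then show "rel (g \<otimes> h) p (act g (act h p))" using rel_comp[OF that(2,1) h] by blast
  qed (use that in simp)
  show "local_on states (act t)" if t: "t \<in> carrier G" for t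
    unfolding local_on_def
  proof (intro ballI allI)
    fix i z assume i: "i \<in> states"
    obtain R f ps R' f' ps' S y where *: "(i, z) = ((R, f), code ps R @- y)" "act t (i, z) = ((R', f'), code ps' R' @- y)"
     "f \<in> F R" "f' \<in> F R'" "chain ps R S" "chain ps' R' S" "f' \<otimes> offset ps' = t \<otimes> (f \<otimes> offset ps)"
      using rel_act[OF t, of "(i, z)"] i unfolding rel_def by blast
    \<comment> \<open>The witness concerns only the decoded prefix, so it remains one when the tail
      \<open>y\<close> is exchanged for \<open>w\<close>.\<close>
    have "act t (i, code ps R @- w) = ((R', f'), code ps' R' @- w)" for w
      by (rule act_eq[OF t]) (use * in \<open>auto simp: rel_def\<close>)
    moreover have "(R', f') \<in> states" using * chain_types by blast
    ultimately show "\<exists>d y j e. z = d @- y \<and> j \<in> states \<and> (\<forall>x. act t (i, d @- x) = (j, e @- x))"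
      using *(1) by blast
  qed
qed

text \<open>The root has no parents, so only the empty chain starts there: the state
  \<open>(root, \<one>)\<close> denotes \<open>\<one>\<close> whatever the stream is.\<close>

lemma act_root:
  assumes "t \<in> carrier G" "act t ((root, \<one>), z) = ((root, \<one>), z')" shows "t = \<one>"
proof -
  have "rel t ((root, \<one>), z) ((root, \<one>), z')" using rel_act[of t "((root, \<one>), z)"] root assms by auto
  then obtain ps ps' S where *: "chain ps root S" "chain ps' root S" "\<one> \<otimes> offset ps' = t \<otimes> (\<one> \<otimes> offset ps)"
    unfolding rel_def by auto
  have "parents root = {}" using root by (auto simp: parents_def)
  then have "ps = []" "ps' = []" using *(1,2) by (cases ps; cases ps'; simp)+
  then show ?thesis using *(3) assms(1) by simp
qed

end

context cone_tree
begin

text \<open>The clopen set with disjoint translates is the copy of the Cantor space at the state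
  \<open>(root, \<one>)\<close>.\<close>

lemma ex_demonstrative_action:
  "\<exists>(Q :: ('a set \<times> 'a) set) q \<alpha>. finite Q \<and> q \<in> Q \<and> cantor_action G Q \<alpha> \<and>
     (\<forall>t\<in>carrier G. \<forall>z z'. \<alpha> t (q, z) = (q, z') \<longrightarrow> t = \<one>)"
proof -
  have "\<forall>R. \<exists>b. parents R \<noteq> {} \<longrightarrow> bij_betw (\<lambda>(p, y). b p @- y) (parents R \<times> UNIV) (UNIV :: bool stream set)"
    using ex_prefix_code finite_parents by blast
  then obtain b where "\<And>R. parents R \<noteq> {} \<Longrightarrow>
      bij_betw (\<lambda>(p, y). b R p @- y) (parents R \<times> UNIV) (UNIV :: bool stream set)" by metis
  then interpret coded_cone_tree G \<Sigma> types F edges root b by unfold_locales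
  show ?thesis
    using fin root cantor_action_act act_root
    by (intro exI[of _ states] exI[of _ "(root, \<one>)"] exI[of _ act]) auto
qed

end

section \<open>Context-free word problems\<close>

text \<open>The triple construction: \<open>Sym q Z (Some q')\<close> and \<open>Lst q \<gamma> (Some q')\<close> generate the words read from
  state \<open>q\<close> while popping \<open>Z\<close> or \<open>\<gamma>\<close> and ending in \<open>q'\<close>; the target \<open>None\<close> stands for reaching a final
  state without going below \<open>Z\<close> or \<open>\<gamma>\<close>.\<close>

datatype ('q, 's) grammar_symbol = Sym 'q 's "'q option" | Lst 'q "'s list" "'q option"

inductive yield :: "('q, 'a, 's) pda \<Rightarrow> ('q, 's) grammar_symbol \<Rightarrow> 'a list \<Rightarrow> bool" for M where
  nil: "yield M (Lst q [] (Some q)) []"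
| final: "q \<in> pda_final M \<Longrightarrow> yield M (Lst q \<gamma> None) []"
| cons: "q' \<in> pda_states M \<Longrightarrow> yield M (Sym q Z (Some q')) x \<Longrightarrow> yield M (Lst q' \<gamma> t) y
    \<Longrightarrow> yield M (Lst q (Z # \<gamma>) t) (x @ y)"
| stop: "yield M (Sym q Z None) x \<Longrightarrow> yield M (Lst q (Z # \<gamma>) None) x"
| step: "(q, a, Z, q', \<beta>) \<in> pda_trans M \<Longrightarrow> yield M (Lst q' \<beta> t) x
    \<Longrightarrow> yield M (Sym q Z t) (case_option [] (\<lambda>b. [b]) a @ x)"

text \<open>Input \<open>w\<close> not yet read and stack \<open>\<delta>\<close> below are
  arbitrary, since runs have to be concatenated. For target \<open>None\<close> the stack left at
  the end is arbitrary too, as acceptance is by final state.\<close>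

primrec simulated :: "('q, 'a, 's) pda \<Rightarrow> ('q, 's) grammar_symbol \<Rightarrow> 'a list \<Rightarrow> bool" where
  "simulated M (Sym q Z t) x \<longleftrightarrow> (\<forall>w \<delta>. case t of
     Some q' \<Rightarrow> (pda_step M)\<^sup>*\<^sup>* (q, x @ w, Z # \<delta>) (q', w, \<delta>)
   | None \<Rightarrow> \<exists>q'\<in>pda_final M. \<exists>\<delta>'. (pda_step M)\<^sup>*\<^sup>* (q, x @ w, Z # \<delta>) (q', w, \<delta>'))"
| "simulated M (Lst q \<gamma> t) x \<longleftrightarrow> (\<forall>w \<delta>. case t of
     Some q' \<Rightarrow> (pda_step M)\<^sup>*\<^sup>* (q, x @ w, \<gamma> @ \<delta>) (q', w, \<delta>)
   | None \<Rightarrow> \<exists>q'\<in>pda_final M. \<exists>\<delta>'. (pda_step M)\<^sup>*\<^sup>* (q, x @ w, \<gamma> @ \<delta>) (q', w, \<delta>'))"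

lemma yield_simulated: "yield M N x \<Longrightarrow> simulated M N x"
proof (induction rule: yield.induct)
  case (cons q' q Z x \<gamma> t y)
  have 1: "(pda_step M)\<^sup>*\<^sup>* (q, (x @ y) @ w, (Z # \<gamma>) @ \<delta>) (q', y @ w, \<gamma> @ \<delta>)" for w \<delta>
    using cons.IH(1) by simp
  show ?case
  proof (cases t)
    case None
    have "\<exists>q''\<in>pda_final M. \<exists>\<delta>'. (pda_step M)\<^sup>*\<^sup>* (q', y @ w, \<gamma> @ \<delta>) (q'', w, \<delta>')" for w \<delta>
      using cons.IH(2) None by simp
    then show ?thesis unfolding None simulated.simps option.case using rtranclp_trans[OF 1] by metis
  next
    case (Some q'')
    have "(pda_step M)\<^sup>*\<^sup>* (q', y @ w, \<gamma> @ \<delta>) (q'', w, \<delta>)" for w \<delta>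
      using cons.IH(2) Some by simp
    then show ?thesis unfolding Some simulated.simps option.case using rtranclp_trans[OF 1] by metis
  qed
next
  case (step q a Z q' \<beta> t x)
  have 1: "pda_step M (q, (case_option [] (\<lambda>b. [b]) a @ x) @ w, Z # \<delta>) (q', x @ w, \<beta> @ \<delta>)" for w \<delta>
    using step.hyps by (cases a) (auto intro: pda_step.intros)
  show ?case
  proof (cases t)
    case None
    have "\<exists>q''\<in>pda_final M. \<exists>\<delta>'. (pda_step M)\<^sup>*\<^sup>* (q', x @ w, \<beta> @ \<delta>) (q'', w, \<delta>')" for w \<delta>
      using step.IH None by simp
    then show ?thesis unfolding None simulated.simps option.case using converse_rtranclp_into_rtranclp[of "pda_step M", OF 1] by metis
  next
    case (Some q'')
    have "(pda_step M)\<^sup>*\<^sup>* (q', x @ w, \<beta> @ \<delta>) (q'', w, \<delta>)" for w \<delta>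
      using step.IH Some by simp
    then show ?thesis unfolding Some simulated.simps option.case using converse_rtranclp_into_rtranclp[of "pda_step M", OF 1] by metis
  qed
qed auto

text \<open>An accepting computation on \<open>\<beta> @ \<gamma>\<close> either accepts without
  going below \<open>\<beta>\<close> or at some moment has popped exactly
  \<open>\<beta>\<close>.\<close>

lemma yield_append_split:
  assumes "yield M (Lst q (\<beta> @ \<gamma>) None) x" "q \<in> pda_states M"
  shows "yield M (Lst q \<beta> None) x \<or>
    (\<exists>q'\<in>pda_states M. \<exists>x1 x2. x = x1 @ x2 \<and> yield M (Lst q \<beta> (Some q')) x1 \<and> yield M (Lst q' \<gamma> None) x2)"
  using assms
proof (induction \<beta> arbitrary: q x)
  case Nil
  then show ?case using yield.nil[of M q] by (metis append_Nil)
next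
  case (Cons Z \<beta>)
  from Cons.prems(1) have "yield M (Lst q (Z # (\<beta> @ \<gamma>)) None) x" by simp
  then consider (1) "x = []" "q \<in> pda_final M"
    | (2) q' y z where "x = y @ z" "q' \<in> pda_states M" "yield M (Sym q Z (Some q')) y" "yield M (Lst q' (\<beta> @ \<gamma>) None) z"
    | (3) "yield M (Sym q Z None) x"
    by (cases rule: yield.cases) auto
  then show ?case
  proof cases
    case 1
    then show ?thesis using yield.final by metis
  next
    case 2
    from Cons.IH[OF 2(4) 2(2)] show ?thesis
    proof
      assume "yield M (Lst q' \<beta> None) z"
      then show ?thesis using 2 yield.cons by metis
    next
      assume "\<exists>q''\<in>pda_states M. \<exists>x1 x2. z = x1 @ x2 \<and> yield M (Lst q' \<beta> (Some q'')) x1 \<and> yield M (Lst q'' \<gamma> None) x2"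
      then obtain q'' x1 x2 where *: "q'' \<in> pda_states M" "z = x1 @ x2" "yield M (Lst q' \<beta> (Some q'')) x1"
        "yield M (Lst q'' \<gamma> None) x2" by blast
      have "yield M (Lst q (Z # \<beta>) (Some q'')) (y @ x1)" using 2 * yield.cons by metis
      then show ?thesis using 2 * by (metis append_assoc)
    qed
  next
    case 3
    then show ?thesis using yield.stop by metis
  qed
qed

text \<open>Backwards along the run: the first move leaves the stack
  \<open>\<beta> @ \<gamma>'\<close>, and the derivation for it is cut at the end of
  \<open>\<beta>\<close> to give one for the symbol \<open>Z\<close> that \<open>\<beta>\<close>
  replaced.\<close>

lemma yield_if_accepting:
  assumes M: "is_pda A M"
    and run: "(pda_step M)\<^sup>*\<^sup>* (q, x, \<gamma>) (q', [], \<delta>)" and q': "q' \<in> pda_final M"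
  shows "yield M (Lst q \<gamma> None) x"
  using run
proof (induction "(q, x, \<gamma>)" arbitrary: q x \<gamma> rule: converse_rtranclp_induct)
  case base
  then show ?case using q' yield.final by metis
next
  case (step c)
  obtain q1 x1 \<gamma>1 where c: "c = (q1, x1, \<gamma>1)" by (cases c)
  have y: "yield M (Lst q1 \<gamma>1 None) x1" using step.hyps(3)[OF c] .
  obtain a Z \<beta> \<gamma>' where *: "(q, a, Z, q1, \<beta>) \<in> pda_trans M" "\<gamma> = Z # \<gamma>'" "\<gamma>1 = \<beta> @ \<gamma>'"
    "x = case_option [] (\<lambda>b. [b]) a @ x1"
    using step.hyps(1) unfolding c by (cases rule: pda_step.cases) (force, force)
  have "q1 \<in> pda_states M" using *(1) M unfolding is_pda_def by blast
  from yield_append_split[OF y[unfolded *(3)] this] show ?case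
  proof
    assume "yield M (Lst q1 \<beta> None) x1"
    then show ?thesis using * yield.step yield.stop by metis
  next
    assume "\<exists>q'\<in>pda_states M. \<exists>y1 y2. x1 = y1 @ y2 \<and> yield M (Lst q1 \<beta> (Some q')) y1 \<and> yield M (Lst q' \<gamma>' None) y2"
    then obtain q2 y1 y2 where **: "q2 \<in> pda_states M" "x1 = y1 @ y2" "yield M (Lst q1 \<beta> (Some q2)) y1"
      "yield M (Lst q2 \<gamma>' None) y2" by blast
    have "yield M (Lst q (Z # \<gamma>') None) ((case_option [] (\<lambda>b. [b]) a @ y1) @ y2)"
      using yield.cons[OF **(1) yield.step[OF *(1) **(3)] **(4)] .
    then show ?thesis using * ** by simp
  qed
qed

lemma pda_language_eq_yield:
  assumes "is_pda A M"
  shows "pda_language M = {w. yield M (Lst (pda_init M) [pda_bottom M] None) w}"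
proof
  show "pda_language M \<subseteq> {w. yield M (Lst (pda_init M) [pda_bottom M] None) w}"
    using yield_if_accepting[OF assms] unfolding pda_language_def by blast
  show "{w. yield M (Lst (pda_init M) [pda_bottom M] None) w} \<subseteq> pda_language M"
  proof
    fix w assume "w \<in> {w. yield M (Lst (pda_init M) [pda_bottom M] None) w}"
    then have "simulated M (Lst (pda_init M) [pda_bottom M] None) w" using yield_simulated by blast
    then have "\<forall>v \<delta>. \<exists>q'\<in>pda_final M. \<exists>\<delta>'. (pda_step M)\<^sup>*\<^sup>* (pda_init M, w @ v, [pda_bottom M] @ \<delta>) (q', v, \<delta>')"
      by simp
    from this[rule_format, of "[]" "[]"] show "w \<in> pda_language M" by (simp add: pda_language_def)
  qed
qed

text \<open>Derivations take lists apart from the front, so below the start symbol only suffixes of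
  the initial stack and of pushed strings occur. This keeps the grammar finite.\<close>

definition stack_words :: "('q, 'a, 's) pda \<Rightarrow> 's list set" where
  "stack_words M = set (suffixes [pda_bottom M]) \<union> (\<Union>(q, a, Z, q', \<beta>)\<in>pda_trans M. set (suffixes \<beta>))"

definition relevant :: "('q, 'a, 's) pda \<Rightarrow> ('q, 's) grammar_symbol set" where
  "relevant M =
     (\<Union>q\<in>pda_states M. (\<Union>Z\<in>pda_stack M. Sym q Z ` insert None (Some ` pda_states M)) \<union>
       (\<Union>\<gamma>\<in>stack_words M. Lst q \<gamma> ` insert None (Some ` pda_states M)))"

lemma finite_relevant:
  assumes "is_pda A M" shows "finite (relevant M)"
proof -
  have "finite (stack_words M)"
    using assms unfolding stack_words_def is_pda_def by (intro finite_UnI finite_UN_I) (auto split: prod.splits)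
  then show ?thesis
    using assms unfolding relevant_def is_pda_def by simp
qed

lemma relevant_simps:
  "Sym q Z t \<in> relevant M \<longleftrightarrow> q \<in> pda_states M \<and> Z \<in> pda_stack M \<and> t \<in> insert None (Some ` pda_states M)"
  "Lst q \<gamma> t \<in> relevant M \<longleftrightarrow> q \<in> pda_states M \<and> \<gamma> \<in> stack_words M \<and> t \<in> insert None (Some ` pda_states M)"
proof -
  have "Sym q Z t \<in> (\<Union>q\<in>A. (\<Union>Z\<in>B. Sym q Z ` C) \<union> (\<Union>\<gamma>\<in>D. Lst q \<gamma> ` C)) \<longleftrightarrow> q \<in> A \<and> Z \<in> B \<and> t \<in> C"
    "Lst q \<gamma> t \<in> (\<Union>q\<in>A. (\<Union>Z\<in>B. Sym q Z ` C) \<union> (\<Union>\<gamma>\<in>D. Lst q \<gamma> ` C)) \<longleftrightarrow> q \<in> A \<and> \<gamma> \<in> D \<and> t \<in> C"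
    for A B C D by blast+
  note * = this
  show "Sym q Z t \<in> relevant M \<longleftrightarrow> q \<in> pda_states M \<and> Z \<in> pda_stack M \<and> t \<in> insert None (Some ` pda_states M)"
    "Lst q \<gamma> t \<in> relevant M \<longleftrightarrow> q \<in> pda_states M \<and> \<gamma> \<in> stack_words M \<and> t \<in> insert None (Some ` pda_states M)"
    unfolding relevant_def by (rule *)+
qed

lemma stack_words_Cons:
  assumes "is_pda A M" "Z # \<gamma> \<in> stack_words M"
  shows "Z \<in> pda_stack M" "\<gamma> \<in> stack_words M"
proof -
  have "suffix (Z # \<gamma>) [pda_bottom M] \<or> (\<exists>q a Y q' \<beta>. (q, a, Y, q', \<beta>) \<in> pda_trans M \<and> suffix (Z # \<gamma>) \<beta>)"
    using assms(2) by (auto simp: stack_words_def)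
  then obtain \<beta> where \<beta>: "suffix (Z # \<gamma>) \<beta>" "\<beta> \<in> lists (pda_stack M)" "set (suffixes \<beta>) \<subseteq> stack_words M"
  proof
    assume "suffix (Z # \<gamma>) [pda_bottom M]"
    then show ?thesis
      by (rule that) (use assms(1) in \<open>auto simp: is_pda_def stack_words_def\<close>)
  next
    assume "\<exists>q a Y q' \<beta>. (q, a, Y, q', \<beta>) \<in> pda_trans M \<and> suffix (Z # \<gamma>) \<beta>"
    then obtain q a Y q' \<beta> where *: "(q, a, Y, q', \<beta>) \<in> pda_trans M" "suffix (Z # \<gamma>) \<beta>" by blast
    show ?thesis
    proof (rule that[OF *(2)])
      show "\<beta> \<in> lists (pda_stack M)" using * assms(1) unfolding is_pda_def by blast
      show "set (suffixes \<beta>) \<subseteq> stack_words M" using *(1) unfolding stack_words_def by force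
    qed
  qed
  show "Z \<in> pda_stack M" using \<beta>(1,2) by (auto simp: suffix_def)
  show "\<gamma> \<in> stack_words M" using \<beta>(1,3) suffix_ConsD by force
qed

lemma stack_words_trans:
  assumes "(q, a, Z, q', \<beta>) \<in> pda_trans M" shows "\<beta> \<in> stack_words M"
  using assms unfolding stack_words_def by force

section \<open>Chords in words that represent the identity\<close>

context group
begin

abbreviation val :: "'a list \<Rightarrow> 'a" where
  "val w \<equiv> foldr (\<otimes>) w \<one>"

lemma val_closed [simp]: "w \<in> lists (carrier G) \<Longrightarrow> val w \<in> carrier G"
  by (induction w) auto

lemma val_append [simp]:
  "u \<in> lists (carrier G) \<Longrightarrow> w \<in> lists (carrier G) \<Longrightarrow> val (u @ w) = val u \<otimes> val w"
  by (induction u) (auto simp: m_assoc)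

text \<open>All words generated by a symbol in the same context have the same value, so the values of
  subderivations range over a finite set. The two chords come from the lowest node of the derivation
  whose yield contains \<open>x2\<close>.\<close>

lemma context_free_chords:
  assumes \<Sigma>: "\<Sigma> \<subseteq> carrier G" and cf: "context_free \<Sigma> (word_problem G \<Sigma>)"
  shows "\<exists>P. finite P \<and> P \<subseteq> carrier G \<and>
    (\<forall>x1 x2 x3. x1 @ x2 @ x3 \<in> word_problem G \<Sigma> \<longrightarrow>
      (\<exists>x11 x12 x21 x22 x31 x32. x1 = x11 @ x12 \<and> x2 = x21 @ x22 \<and> x3 = x31 @ x32 \<and>
         val (x12 @ x21) \<in> P \<and> val (x22 @ x31) \<in> P))"
proof -
  let ?W = "word_problem G \<Sigma>"
  obtain M :: "(nat, 'a, nat) pda" where M: "is_pda \<Sigma> M" and lang: "pda_language M = ?W" and fin: "finite \<Sigma>"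
    using cf unfolding context_free_def by blast
  have lists: "x \<in> lists \<Sigma>" "x \<in> lists (carrier G)" if "l @ x @ r \<in> ?W" for l x r
    using that \<Sigma> by (auto simp: word_problem_def)
  define x\<^sub>0 where "x\<^sub>0 N = (SOME x. yield M N x)" for N
  \<comment> \<open>The letters of \<open>\<Sigma>\<close> are needed for a chord that cuts off a
    single letter. The restriction to the carrier discards meaningless values of
    \<open>x\<^sub>0 N\<close>, as may arise when \<open>N\<close> generates nothing.\<close>
  define P where "P = insert \<one> (\<Sigma> \<union> {g \<in> carrier G. g \<in> (\<lambda>N. val (x\<^sub>0 N)) ` relevant M})"
  \<comment> \<open>In place of derivation trees with a marked node, only the surrounding words are
    kept; they complete every word of \<open>N\<close> to one of value
    \<open>\<one>\<close>.\<close>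
  define occurs where "occurs N l r \<longleftrightarrow> N \<in> relevant M \<and> (\<forall>x. yield M N x \<longrightarrow> l @ x @ r \<in> ?W)" for N l r
  have P_val: "val x \<in> P" if occ: "occurs N l r" and x: "yield M N x" for N l r x
  proof -
    have x0: "yield M N (x\<^sub>0 N)" unfolding x\<^sub>0_def using x by (rule someI)
    have W: "l @ x @ r \<in> ?W" "l @ x\<^sub>0 N @ r \<in> ?W" using occ x x0 unfolding occurs_def by blast+
    have l: "l \<in> lists (carrier G)" and r: "r \<in> lists (carrier G)"
      using lists(2)[of "[]" l "x @ r"] lists(2)[of "l @ x" r "[]"] W(1) by simp_all
    note x_in = lists(2)[OF W(1)] lists(2)[OF W(2)]
    have "val l \<otimes> (val x \<otimes> val r) = val l \<otimes> (val (x\<^sub>0 N) \<otimes> val r)"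
      using W l r x_in by (simp add: word_problem_def del: foldr_append)
    then have "val x = val (x\<^sub>0 N)" using l r x_in by simp
    then show ?thesis using occ x_in by (auto simp: P_def occurs_def)
  qed
  have P_one: "\<one> \<in> P" by (simp add: P_def)
  define split where "split x1 x2 x3 \<longleftrightarrow>
    (\<exists>x11 x12 x21 x22 x31 x32. x1 = x11 @ x12 \<and> x2 = x21 @ x22 \<and> x3 = x31 @ x32 \<and>
         val (x12 @ x21) \<in> P \<and> val (x22 @ x31) \<in> P)" for x1 x2 x3
  have split_Nil: "split x1 [] x3" for x1 x3
    unfolding split_def using P_one by (intro exI[of _ x1] exI[of _ "[]"] exI[of _ x3]) simp
  have split_mono: "split (l @ x1) x2 (x3 @ r)" if "split x1 x2 x3" for l x1 x2 x3 r
    using that unfolding split_def by (metis append_assoc)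
  have split_cut: "split x1 (y @ z) x3" if "val (x1 @ y) \<in> P" "val (z @ x3) \<in> P" for x1 y z x3
    unfolding split_def using that by (metis append_Nil append_Nil2)
  have main: "split x1 x2 x3" if "yield M N x" "occurs N l r" "x = x1 @ x2 @ x3" for N x l r x1 x2 x3
    using that
  proof (induction arbitrary: l r x1 x2 x3 rule: yield.induct)
    case (cons q' q Z x \<gamma> t y)
    have rel: "Sym q Z (Some q') \<in> relevant M" "Lst q' \<gamma> t \<in> relevant M"
      using cons.prems(1) cons.hyps(1) stack_words_Cons[OF M, of Z \<gamma>] by (auto simp: occurs_def relevant_simps)
    have occ1: "occurs (Sym q Z (Some q')) l (y @ r)"
      using cons.prems(1) cons.hyps rel yield.cons[of q' M q Z _ \<gamma> t y] unfolding occurs_def by (metis append_assoc)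
    have occ2: "occurs (Lst q' \<gamma> t) (l @ x) r"
      using cons.prems(1) cons.hyps rel yield.cons[of q' M q Z x \<gamma> t] unfolding occurs_def by (metis append_assoc)
    \<comment> \<open>Either one of the two subderivations contains all of \<open>x2\<close>, or the
      cut falls inside \<open>x2\<close>; then the two subderivations themselves are the
      chords.\<close>
    consider c where "x = x1 @ x2 @ c" "x3 = c @ y" | c where "x1 = x @ c" "y = c @ x2 @ x3"
      | c d where "x = x1 @ c" "y = d @ x3" "x2 = c @ d"
      using cons.prems(2) by (auto simp: append_eq_append_conv2)
    then show ?case
    proof cases
      case 1
      then show ?thesis using cons.IH(1)[OF occ1] split_mono[of x1 x2 c "[]" y] by simp
    next
      case 2
      then show ?thesis using cons.IH(2)[OF occ2] split_mono[of c x2 x3 x "[]"] by simp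
    next
      case 3
      then show ?thesis using split_cut P_val[OF occ1 cons.hyps(2)] P_val[OF occ2 cons.hyps(3)] by simp
    qed
  next
    case (stop q Z x \<gamma>)
    have "Sym q Z None \<in> relevant M"
      using stop.prems(1) stack_words_Cons[OF M, of Z \<gamma>] by (auto simp: occurs_def relevant_simps)
    then have "occurs (Sym q Z None) l r"
      using stop.prems(1) yield.stop unfolding occurs_def by metis
    then show ?case using stop by blast
  next
    case (step q a Z q' \<beta> t x)
    let ?a = "case_option [] (\<lambda>b. [b]) a"
    have "Lst q' \<beta> t \<in> relevant M"
      using step.prems(1) stack_words_trans[OF step.hyps(1)] step.hyps(1) M
      unfolding is_pda_def by (auto simp: occurs_def relevant_simps)
    then have occ: "occurs (Lst q' \<beta> t) (l @ ?a) r"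
      using step.prems(1) yield.step[OF step.hyps(1)] unfolding occurs_def by (metis append_assoc)
    show ?case
    proof (cases "x2 = []")
      case True
      then show ?thesis using split_Nil by simp
    next
      case x2: False
      \<comment> \<open>The letter just read may be the first letter of \<open>x2\<close>; it is
        then one chord, and the remaining derivation is the other.\<close>
      consider c where "x1 = ?a @ c" "x = c @ x2 @ x3" | b d where "a = Some b" "x1 = []" "x2 = b # d" "x = d @ x3"
        using step.prems(2) x2 by (cases a; cases x1; cases x2) auto
      then show ?thesis
      proof cases
        case 1
        then show ?thesis using step.IH[OF occ, of c x2 x3] split_mono[of c x2 x3 ?a "[]"] by simp
      next
        case 2
        have "l @ (?a @ x) @ r \<in> ?W"
          using step.prems(1) yield.step[OF step.hyps(1,2)] unfolding occurs_def by blast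
        then have "b \<in> \<Sigma>" using lists(1)[of l "?a @ x" r] 2 by simp
        then have "val ([] @ [b]) \<in> P" using \<Sigma> by (auto simp: P_def)
        moreover have "val (d @ x3) \<in> P" using P_val[OF occ step.hyps(2)] 2 by simp
        ultimately show ?thesis using split_cut[of "[]" "[b]" d x3] 2 by simp
      qed
    qed
  qed (use split_Nil in auto)
  have "occurs (Lst (pda_init M) [pda_bottom M] None) [] []"
    using M lang pda_language_eq_yield[OF M] unfolding is_pda_def
    by (auto simp: occurs_def relevant_simps stack_words_def)
  then have "split x1 x2 x3" if "x1 @ x2 @ x3 \<in> ?W" for x1 x2 x3
    using main that pda_language_eq_yield[OF M] lang by blast
  moreover have "finite P" "P \<subseteq> carrier G"
    using fin finite_relevant[OF M] \<Sigma> by (auto simp: P_def)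
  ultimately show ?thesis unfolding split_def by blast
qed

end

section \<open>Cones in Cayley graphs\<close>

text \<open>All that is kept of context-freeness is \<open>chords\<close>: however a closed path is
  divided into three pieces, two chords with values in \<open>P\<close> join one point of the middle
  piece to the two outer pieces.\<close>

locale cayley_graph = group G for G (structure) +
  fixes \<Sigma> :: "'a set" and P :: "'a set"
  assumes \<Sigma>: "finite \<Sigma>" "\<Sigma> \<subseteq> carrier G" "\<And>s. s \<in> \<Sigma> \<Longrightarrow> inv s \<in> \<Sigma>" "generate G \<Sigma> = carrier G"
    and P: "finite P" "P \<subseteq> carrier G"
    and chords: "\<And>x1 x2 x3. x1 @ x2 @ x3 \<in> word_problem G \<Sigma> \<Longrightarrow>
      \<exists>x11 x12 x21 x22 x31 x32. x1 = x11 @ x12 \<and> x2 = x21 @ x22 \<and> x3 = x31 @ x32 \<and>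
         val (x12 @ x21) \<in> P \<and> val (x22 @ x31) \<in> P"
begin

lemma words: "w \<in> lists \<Sigma> \<Longrightarrow> w \<in> lists (carrier G)"
  using \<Sigma> by auto

lemma ex_word: "g \<in> carrier G \<Longrightarrow> \<exists>w\<in>lists \<Sigma>. val w = g"
proof -
  assume "g \<in> carrier G"
  then have "g \<in> generate G \<Sigma>" using \<Sigma> by simp
  then show ?thesis
  proof (induction rule: generate.induct)
    case one
    show ?case by (intro bexI[of _ "[]"]) auto
  next
    case (incl h)
    then show ?case using \<Sigma> by (intro bexI[of _ "[h]"]) auto
  next
    case (inv h)
    then show ?case using \<Sigma> by (intro bexI[of _ "[inv h]"]) auto
  next
    case (eng g h)
    then obtain u w where "u \<in> lists \<Sigma>" "val u = g" "w \<in> lists \<Sigma>" "val w = h" by blast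
    then show ?case using words by (intro bexI[of _ "u @ w"]) (auto simp del: foldr_append)
  qed
qed

text \<open>Connectedness of the Cayley graph in which a letter \<open>s\<close> joins
  \<open>x\<close> to \<open>s \<otimes> x\<close>.\<close>

lemma invariant_set:
  assumes "A \<subseteq> carrier G" "a \<in> A" "\<And>s x. s \<in> \<Sigma> \<Longrightarrow> x \<in> A \<Longrightarrow> s \<otimes> x \<in> A"
  shows "A = carrier G"
proof
  show "carrier G \<subseteq> A"
  proof
    fix g assume g: "g \<in> carrier G"
    have a: "a \<in> carrier G" using assms by blast
    have "val w \<otimes> a \<in> A" if "w \<in> lists \<Sigma>" for w
      using that
    proof (induction w)
      case (Cons s w)
      then have "s \<otimes> (val w \<otimes> a) \<in> A" using assms(3) by simp
      moreover have "s \<in> carrier G" "val w \<in> carrier G" using Cons \<Sigma> words[of w] by auto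
      ultimately show ?case using a by (simp add: m_assoc)
    qed (use assms a in simp)
    moreover obtain w where "w \<in> lists \<Sigma>" "val w = g \<otimes> inv a" using ex_word g a by (meson inv_closed m_closed)
    ultimately show "g \<in> A" using g a by (metis inv_closed l_inv m_assoc r_one)
  qed
qed fact

definition len :: "'a \<Rightarrow> nat" where
  "len g = (LEAST n. \<exists>w\<in>lists \<Sigma>. val w = g \<and> length w = n)"

lemma len_word:
  assumes "g \<in> carrier G" obtains w where "w \<in> lists \<Sigma>" "val w = g" "length w = len g"
proof -
  have "\<exists>n. \<exists>w\<in>lists \<Sigma>. val w = g \<and> length w = n" using ex_word[OF assms] by blast
  then have "\<exists>w\<in>lists \<Sigma>. val w = g \<and> length w = len g" unfolding len_def by (rule LeastI_ex)
  then show ?thesis using that by blast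
qed

lemma len_val_le: "w \<in> lists \<Sigma> \<Longrightarrow> len (val w) \<le> length w"
  unfolding len_def by (intro Least_le) blast

lemma len_mult_le:
  assumes "g \<in> carrier G" "h \<in> carrier G" shows "len (g \<otimes> h) \<le> len g + len h"
proof -
  obtain u where "u \<in> lists \<Sigma>" "val u = g" "length u = len g" using len_word assms by metis
  moreover obtain w where "w \<in> lists \<Sigma>" "val w = h" "length w = len h" using len_word assms by metis
  ultimately show ?thesis using len_val_le[of "u @ w"] words by (auto simp del: foldr_append)
qed

lemma len_one: "len \<one> = 0"
  using len_val_le[of "[]"] by simp

lemma len_eq_0: "g \<in> carrier G \<Longrightarrow> len g = 0 \<Longrightarrow> g = \<one>"
  using len_word[of g] by (metis foldr.simps(1) id_apply length_0_conv)

lemma len_inv_le: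
  assumes "g \<in> carrier G" shows "len (inv g) \<le> len g"
proof -
  have *: "\<exists>v\<in>lists \<Sigma>. val v = inv (val w) \<and> length v = length w" if "w \<in> lists \<Sigma>" for w
    using that
  proof (induction w)
    case (Cons s w)
    then obtain v where v: "v \<in> lists \<Sigma>" "val v = inv (val w)" "length v = length w" by auto
    have c: "s \<in> carrier G" "val w \<in> carrier G" "inv s \<in> \<Sigma>" using Cons \<Sigma> words[of w] by auto
    then have "val (v @ [inv s]) = inv (s \<otimes> val w)"
      using v words by (simp add: inv_mult_group del: foldr_append)
    then show ?case using v c by (intro bexI[of _ "v @ [inv s]"]) (simp_all del: foldr_append)
  qed simp
  obtain w where "w \<in> lists \<Sigma>" "val w = g" "length w = len g" using len_word assms by metis
  then show ?thesis using * len_val_le by metis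
qed

lemma len_inv: "g \<in> carrier G \<Longrightarrow> len (inv g) = len g"
  using len_inv_le[of g] len_inv_le[of "inv g"] by simp

lemma len_step_down:
  assumes "g \<in> carrier G" "len g = Suc n" obtains s where "s \<in> \<Sigma>" "len (s \<otimes> g) \<le> n"
proof -
  obtain w where w: "w \<in> lists \<Sigma>" "val w = g" "length w = Suc n" using len_word assms by metis
  then obtain s v where v: "w = s # v" by (cases w) auto
  then have c: "s \<in> carrier G" "s \<in> \<Sigma>" "v \<in> lists \<Sigma>" "val v \<in> carrier G" using w \<Sigma> words[of v] by auto
  then have "inv s \<otimes> (s \<otimes> val v) = val v" by (simp flip: m_assoc)
  then have "inv s \<otimes> g = val v" using w v by simp
  then show ?thesis using that[of "inv s"] c len_val_le[of v] w v \<Sigma> by auto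
qed

definition ball :: "nat \<Rightarrow> 'a set" where
  "ball n = {g \<in> carrier G. len g \<le> n}"

lemma finite_ball: "finite (ball n)"
proof -
  have "ball n \<subseteq> val ` {w. set w \<subseteq> \<Sigma> \<and> length w \<le> n}"
  proof
    fix g assume "g \<in> ball n"
    then have g: "g \<in> carrier G" "len g \<le> n" by (auto simp: ball_def)
    obtain w where "w \<in> lists \<Sigma>" "val w = g" "length w = len g" using len_word g by metis
    then show "g \<in> val ` {w. set w \<subseteq> \<Sigma> \<and> length w \<le> n}" using g by (intro image_eqI) auto
  qed
  then show ?thesis using finite_lists_length_le[OF \<Sigma>(1)] finite_surj by blast
qed

section \<open>Components and boundaries in the Cayley graph\<close>

definition adj :: "'a set \<Rightarrow> 'a \<Rightarrow> 'a \<Rightarrow> bool" where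
  "adj Y a b \<longleftrightarrow> a \<in> Y \<and> b \<in> Y \<and> (\<exists>s\<in>\<Sigma>. b = s \<otimes> a)"

definition comp :: "'a set \<Rightarrow> 'a \<Rightarrow> 'a set" where
  "comp Y a = {b. (adj Y)\<^sup>*\<^sup>* a b}"

definition translate :: "'a set \<Rightarrow> 'a \<Rightarrow> 'a set" where
  "translate R h = (\<lambda>x. x \<otimes> h) ` R"

definition bd :: "'a set \<Rightarrow> 'a set" where
  "bd R = {x \<in> R. \<exists>s\<in>\<Sigma>. s \<otimes> x \<notin> R}"

lemma adj_sym:
  assumes "Y \<subseteq> carrier G" "adj Y a b" shows "adj Y b a"
proof -
  obtain s where s: "s \<in> \<Sigma>" "b = s \<otimes> a" using assms(2) by (auto simp: adj_def)
  then have "s \<in> carrier G" "a \<in> carrier G" using \<Sigma> assms by (auto simp: adj_def)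
  then have "a = inv s \<otimes> b" using s by (simp flip: m_assoc)
  then show ?thesis using assms(2) \<Sigma>(3)[OF s(1)] unfolding adj_def by blast
qed

lemma adj_star_sym:
  assumes "Y \<subseteq> carrier G" "(adj Y)\<^sup>*\<^sup>* a b" shows "(adj Y)\<^sup>*\<^sup>* b a"
  using assms(2)
proof (induction rule: rtranclp_induct)
  case (step y z)
  then show ?case using adj_sym[OF assms(1)] by (meson converse_rtranclp_into_rtranclp)
qed simp

lemma comp_subset: "a \<in> Y \<Longrightarrow> comp Y a \<subseteq> Y"
proof
  fix b assume a: "a \<in> Y" and "b \<in> comp Y a"
  then have "(adj Y)\<^sup>*\<^sup>* a b" by (simp add: comp_def)
  then show "b \<in> Y" using a by (induction rule: rtranclp_induct) (auto simp: adj_def)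
qed

lemma comp_self: "a \<in> comp Y a"
  by (simp add: comp_def)

lemma comp_step: "b \<in> comp Y a \<Longrightarrow> a \<in> Y \<Longrightarrow> s \<in> \<Sigma> \<Longrightarrow> s \<otimes> b \<in> Y \<Longrightarrow> s \<otimes> b \<in> comp Y a"
proof -
  assume *: "b \<in> comp Y a" "a \<in> Y" "s \<in> \<Sigma>" "s \<otimes> b \<in> Y"
  then have "adj Y b (s \<otimes> b)" using comp_subset unfolding adj_def by blast
  then show ?thesis using *(1) unfolding comp_def by simp
qed

lemma comp_eq:
  assumes "Y \<subseteq> carrier G" "b \<in> comp Y a" shows "comp Y b = comp Y a"
proof -
  have ab: "(adj Y)\<^sup>*\<^sup>* a b" using assms(2) by (simp add: comp_def)
  then have "(adj Y)\<^sup>*\<^sup>* b a" using adj_star_sym[OF assms(1)] by blast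
  then show ?thesis using ab by (auto simp: comp_def intro: rtranclp_trans)
qed

lemma comp_connected:
  assumes "Y \<subseteq> carrier G" "a \<in> Y" "b \<in> comp Y a" "c \<in> comp Y a"
  shows "(adj (comp Y a))\<^sup>*\<^sup>* b c"
proof -
  have "c \<in> comp Y b" using comp_eq assms by blast
  then have "(adj Y)\<^sup>*\<^sup>* b c" by (simp add: comp_def)
  then show ?thesis
  proof (induction rule: rtranclp_induct)
    case (step y z)
    have "y \<in> comp Y b" "z \<in> comp Y b" using step(1,2) by (auto simp: comp_def)
    then have "adj (comp Y a) y z" using step(2) comp_eq[OF assms(1,3)] by (auto simp: adj_def)
    then show ?case using step by simp
  qed simp
qed

text \<open>Letters act from the left, so the vertices along the path belong to the suffixes of
  \<open>w\<close>.\<close>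

lemma path_word:
  assumes "(adj C)\<^sup>*\<^sup>* u v" "C \<subseteq> carrier G" "u \<in> C"
  shows "\<exists>w\<in>lists \<Sigma>. v = val w \<otimes> u \<and> (\<forall>w1 w2. w = w1 @ w2 \<longrightarrow> val w2 \<otimes> u \<in> C)"
  using assms(1)
proof (induction rule: rtranclp_induct)
  case base
  then show ?case using assms by (intro bexI[of _ "[]"]) auto
next
  case (step y z)
  then obtain w where w: "w \<in> lists \<Sigma>" "y = val w \<otimes> u" "\<And>w1 w2. w = w1 @ w2 \<Longrightarrow> val w2 \<otimes> u \<in> C" by blast
  obtain s where s: "s \<in> \<Sigma>" "z = s \<otimes> y" "z \<in> C" using step(2) by (auto simp: adj_def)
  have cl: "s \<in> carrier G" "val w \<in> carrier G" "u \<in> carrier G" using s w \<Sigma> words assms by auto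
  then have z: "z = val (s # w) \<otimes> u" using s w by (simp add: m_assoc)
  have "val w2 \<otimes> u \<in> C" if "s # w = w1 @ w2" for w1 w2
    using that w(3) z s(3) by (cases w1) auto
  then show ?case using z s w by (intro bexI[of _ "s # w"]) auto
qed

section \<open>Frontiers of bounded width\<close>

definition level :: "nat \<Rightarrow> 'a set" where
  "level n = {g \<in> carrier G. n \<le> len g}"

definition chord_bound :: nat where
  "chord_bound = Max (insert 0 (len ` P))"

lemma len_chord: "g \<in> P \<Longrightarrow> len g \<le> chord_bound"
  unfolding chord_bound_def using P by simp

text \<open>The shape of a route from \<open>u\<close> to \<open>v\<close>, read from right to left:
  down the geodesic of \<open>u\<close>, over the two chords, and up the geodesic of
  \<open>v\<close>.\<close>

definition width_set :: "'a set" where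
  "width_set = (\<lambda>(a, b, c, d). inv a \<otimes> b \<otimes> c \<otimes> inv d) `
     (ball chord_bound \<times> P \<times> P \<times> ball chord_bound)"

lemma finite_width_set: "finite width_set"
  unfolding width_set_def using finite_ball P by simp

text \<open>The path inside the component together with geodesics from \<open>u\<close> and \<open>v\<close> to \<open>\<one>\<close> reads a word of the
  word problem. The middle vertex of the two chords has length at least \<open>n\<close>, so their ends
  on the geodesics are close to \<open>u\<close> and \<open>v\<close>.\<close>

lemma frontier_narrow:
  assumes a: "a \<in> level n" and u: "u \<in> comp (level n) a" "len u = n" and v: "v \<in> comp (level n) a" "len v = n"
  shows "v \<otimes> inv u \<in> width_set"
proof -
  let ?K = chord_bound
  have lvl: "level n \<subseteq> carrier G" by (auto simp: level_def)
  have C: "comp (level n) a \<subseteq> level n" using comp_subset a by blast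
  have uv: "u \<in> carrier G" "v \<in> carrier G" using u v C lvl by blast+
  obtain x2 where x2: "x2 \<in> lists \<Sigma>" "v = val x2 \<otimes> u" "\<And>w1 w2. x2 = w1 @ w2 \<Longrightarrow> val w2 \<otimes> u \<in> comp (level n) a"
    using path_word[OF comp_connected[OF lvl a u(1) v(1)]] C lvl u(1) by blast
  obtain x3 where x3: "x3 \<in> lists \<Sigma>" "val x3 = u" "length x3 = n" using len_word[OF uv(1)] u(2) by metis
  obtain x1 where x1: "x1 \<in> lists \<Sigma>" "val x1 = inv v" "length x1 = n"
    using len_word[of "inv v"] uv(2) v(2) len_inv by (metis inv_closed)
  have "val (x1 @ x2 @ x3) = \<one>"
    using x1 x2 x3 uv words by (simp del: foldr_append)
  then have "x1 @ x2 @ x3 \<in> word_problem G \<Sigma>"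
    using x1 x2 x3 by (simp add: word_problem_def)
  then obtain x11 x12 x21 x22 x31 x32 where s: "x1 = x11 @ x12" "x2 = x21 @ x22" "x3 = x31 @ x32"
    "val (x12 @ x21) \<in> P" "val (x22 @ x31) \<in> P" by (elim chords[elim_format] exE conjE)
  have w: "x11 \<in> lists \<Sigma>" "x12 \<in> lists \<Sigma>" "x21 \<in> lists \<Sigma>" "x22 \<in> lists \<Sigma>" "x31 \<in> lists \<Sigma>" "x32 \<in> lists \<Sigma>"
    using x1 x2 x3 s by auto
  note cl = w[THEN words]
  note vcl = cl[THEN val_closed]
  \<comment> \<open>The vertex \<open>val x22 \<otimes> u\<close> belongs to both chords and has
    length at least \<open>n\<close>. One chord joins it to \<open>val x32\<close>, of length at
    most \<open>length x32\<close>; as \<open>length x31 + length x32 = n\<close>, the piece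
    \<open>x31\<close> is no longer than the chord bound. The other side is symmetric.\<close>
  have m: "n \<le> len (val x22 \<otimes> u)" using x2(3)[OF s(2)] C by (auto simp: level_def)
  have "val x22 \<otimes> u = val (x22 @ x31) \<otimes> val x32"
    using x3(2)[symmetric] s(3) cl vcl by (simp add: m_assoc del: foldr_append)
  then have "len (val x22 \<otimes> u) \<le> ?K + length x32"
    using len_mult_le[of "val (x22 @ x31)" "val x32"] len_chord[OF s(5)] len_val_le[OF w(6)] cl vcl
    by (simp del: foldr_append)
  then have K1: "length x31 \<le> ?K" using m x3(3) s(3) by simp
  have "val x22 \<otimes> u = inv (val (x12 @ x21)) \<otimes> inv (val x11)"
  proof -
    have "val x11 \<otimes> val x12 \<otimes> (val x21 \<otimes> (val x22 \<otimes> u)) = \<one>"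
      using x1(2) x2(2) s cl vcl uv by (simp add: m_assoc del: foldr_append)
    then have "(val x11 \<otimes> val (x12 @ x21)) \<otimes> (val x22 \<otimes> u) = \<one>"
      using cl vcl uv by (simp add: m_assoc del: foldr_append)
    then have "val x22 \<otimes> u = inv (val x11 \<otimes> val (x12 @ x21))"
      using cl vcl uv inv_equality[of "val x11 \<otimes> val (x12 @ x21)" "val x22 \<otimes> u"]
      by (metis (no_types, lifting) inv_equality inv_inv m_closed val_append)
    then show ?thesis using cl vcl by (simp add: inv_mult_group del: foldr_append)
  qed
  then have "len (val x22 \<otimes> u) \<le> ?K + length x11"
    using len_mult_le[of "inv (val (x12 @ x21))" "inv (val x11)"] len_chord[OF s(4)] len_val_le[OF w(1)] cl vcl
    by (simp add: len_inv del: foldr_append)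
  then have K2: "length x12 \<le> ?K" using m x1(3) s(1) by simp
  have "v \<otimes> inv u = val x21 \<otimes> val x22"
    using x2(2) s(2) cl vcl uv by (simp add: m_assoc del: foldr_append)
  also have "\<dots> = inv (val x12) \<otimes> val (x12 @ x21) \<otimes> val (x22 @ x31) \<otimes> inv (val x31)"
  proof -
    have "inv (val x12) \<otimes> val (x12 @ x21) = val x21"
      using cl vcl by (simp add: m_assoc[symmetric] del: foldr_append)
    moreover have "val (x22 @ x31) \<otimes> inv (val x31) = val x22"
      using cl vcl by (simp add: m_assoc del: foldr_append)
    ultimately show ?thesis using cl vcl by (simp add: m_assoc del: foldr_append val_append)
  qed
  finally have "v \<otimes> inv u = (\<lambda>(a, b, c, d). inv a \<otimes> b \<otimes> c \<otimes> inv d) (val x12, val (x12 @ x21), val (x22 @ x31), val x31)"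
    by simp
  moreover have "val x12 \<in> ball ?K" "val x31 \<in> ball ?K"
    using K1 K2 len_val_le[OF w(2)] len_val_le[OF w(5)] vcl by (auto simp: ball_def)
  ultimately show ?thesis unfolding width_set_def using s by blast
qed

section \<open>Right translations\<close>

lemma translate_translate:
  "R \<subseteq> carrier G \<Longrightarrow> g \<in> carrier G \<Longrightarrow> h \<in> carrier G \<Longrightarrow>
    translate (translate R g) h = translate R (g \<otimes> h)"
  unfolding translate_def image_image by (rule image_cong) (auto simp: m_assoc)

lemma translate_one: "R \<subseteq> carrier G \<Longrightarrow> translate R \<one> = R"
  unfolding translate_def by force

lemma translate_carrier: "R \<subseteq> carrier G \<Longrightarrow> h \<in> carrier G \<Longrightarrow> translate R h \<subseteq> carrier G"
  unfolding translate_def by auto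

lemma inj_translate: "h \<in> carrier G \<Longrightarrow> inj_on (\<lambda>x. x \<otimes> h) (carrier G)"
  by (rule inj_onI) simp

lemma translate_mem_iff:
  "R \<subseteq> carrier G \<Longrightarrow> h \<in> carrier G \<Longrightarrow> x \<in> carrier G \<Longrightarrow> x \<otimes> h \<in> translate R h \<longleftrightarrow> x \<in> R"
  unfolding translate_def using inj_on_image_mem_iff[OF inj_translate] by blast

lemma translate_inj:
  "R \<subseteq> carrier G \<Longrightarrow> S \<subseteq> carrier G \<Longrightarrow> h \<in> carrier G \<Longrightarrow> translate R h = translate S h \<Longrightarrow> R = S"
  unfolding translate_def using inj_on_image_eq_iff[OF inj_translate] by blast

lemma translate_carrier_eq: "h \<in> carrier G \<Longrightarrow> translate (carrier G) h = carrier G"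
proof -
  assume h: "h \<in> carrier G"
  have "x \<in> translate (carrier G) h" if "x \<in> carrier G" for x
    unfolding translate_def using that h by (intro image_eqI[of _ _ "x \<otimes> inv h"]) (auto simp: m_assoc)
  then show ?thesis using translate_carrier[OF subset_refl h] by blast
qed

lemma bd_translate:
  assumes R: "R \<subseteq> carrier G" and h: "h \<in> carrier G" shows "bd (translate R h) = translate (bd R) h"
proof -
  have "x \<otimes> h \<in> bd (translate R h) \<longleftrightarrow> x \<in> bd R" if x: "x \<in> R" for x
  proof -
    have "s \<otimes> (x \<otimes> h) \<in> translate R h \<longleftrightarrow> s \<otimes> x \<in> R" if "s \<in> \<Sigma>" for s
    proof -
      have c: "s \<in> carrier G" "x \<in> carrier G" using that x R \<Sigma> by auto
      then show ?thesis using translate_mem_iff[OF R h, of "s \<otimes> x"] h by (simp add: m_assoc)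
    qed
    then show ?thesis using x R h translate_mem_iff[OF R h, of x] by (auto simp: bd_def)
  qed
  moreover have "bd (translate R h) \<subseteq> (\<lambda>x. x \<otimes> h) ` R" "bd R \<subseteq> R" by (auto simp: bd_def translate_def)
  ultimately show ?thesis unfolding translate_def[of "bd R"] by blast
qed

lemma comp_mono:
  assumes "Y \<subseteq> Z" shows "comp Y a \<subseteq> comp Z a"
proof -
  have "(adj Y)\<^sup>*\<^sup>* \<le> (adj Z)\<^sup>*\<^sup>*" using assms by (intro rtranclp_mono) (auto simp: adj_def)
  then show ?thesis by (auto simp: comp_def)
qed

lemma translate_comp_subset:
  assumes "Y \<subseteq> carrier G" "h \<in> carrier G"
  shows "translate (comp Y a) h \<subseteq> comp (translate Y h) (a \<otimes> h)"
proof -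
  have "(adj (translate Y h))\<^sup>*\<^sup>* (a \<otimes> h) (b \<otimes> h)" if "(adj Y)\<^sup>*\<^sup>* a b" for b
    using that
  proof (induction rule: rtranclp_induct)
    case (step y z)
    obtain s where s: "s \<in> \<Sigma>" "z = s \<otimes> y" "y \<in> Y" "z \<in> Y" using step(2) by (auto simp: adj_def)
    then have "s \<in> carrier G" "y \<in> carrier G" using \<Sigma> assms by auto
    then have "z \<otimes> h = s \<otimes> (y \<otimes> h)" using s assms by (simp add: m_assoc)
    then have "adj (translate Y h) (y \<otimes> h) (z \<otimes> h)" using s(1,3,4) unfolding adj_def translate_def by blast
    then show ?case using step by simp
  qed simp
  then show ?thesis by (auto simp: translate_def comp_def)
qed

lemma comp_translate:
  assumes Y: "Y \<subseteq> carrier G" and h: "h \<in> carrier G" and a: "a \<in> Y"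
  shows "comp (translate Y h) (a \<otimes> h) = translate (comp Y a) h"
proof
  have ac: "a \<in> carrier G" using a Y by blast
  let ?C = "comp (translate Y h) (a \<otimes> h)"
  have "a \<otimes> h \<in> translate Y h" using a by (simp add: translate_def)
  then have C: "?C \<subseteq> carrier G" using comp_subset translate_carrier[OF Y h] by blast
  have "translate ?C (inv h) \<subseteq> comp (translate (translate Y h) (inv h)) (a \<otimes> h \<otimes> inv h)"
    using translate_comp_subset[OF translate_carrier[OF Y h]] h by simp
  also have "\<dots> = comp Y a" using Y h ac by (simp add: translate_translate translate_one m_assoc)
  finally have "translate (translate ?C (inv h)) h \<subseteq> translate (comp Y a) h"
    unfolding translate_def by blast
  then show "?C \<subseteq> translate (comp Y a) h" using C h by (simp add: translate_translate translate_one)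
qed (rule translate_comp_subset[OF Y h])

text \<open>One step out of the component leaves the level set itself, which is possible only from
  its lowest sphere; conversely a geodesic to \<open>\<one>\<close> leaves at once. At level 0 this
  fails, because no edge leaves the whole group.\<close>

lemma bd_comp_level:
  assumes a: "a \<in> level (Suc n)"
  shows "bd (comp (level (Suc n)) a) = {x \<in> comp (level (Suc n)) a. len x = Suc n}"
proof -
  let ?C = "comp (level (Suc n)) a"
  have C: "?C \<subseteq> level (Suc n)" using comp_subset a by blast
  have "len x = Suc n" if x: "x \<in> ?C" and s: "s \<in> \<Sigma>" "s \<otimes> x \<notin> ?C" for x s
  proof -
    have c: "s \<in> carrier G" "x \<in> carrier G" "Suc n \<le> len x" using x s C \<Sigma> by (auto simp: level_def)
    have "s \<otimes> x \<notin> level (Suc n)" using comp_step[OF x a s(1)] s(2) by blast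
    then have sx: "len (s \<otimes> x) \<le> n" using c by (auto simp: level_def)
    have "len (inv s) \<le> 1" using len_val_le[of "[inv s]"] \<Sigma>(3)[OF s(1)] c by simp
    moreover have "x = inv s \<otimes> (s \<otimes> x)" using c by (simp flip: m_assoc)
    ultimately have "len x \<le> Suc n" using len_mult_le[of "inv s" "s \<otimes> x"] c sx by simp
    then show ?thesis using c by simp
  qed
  moreover have "\<exists>s\<in>\<Sigma>. s \<otimes> x \<notin> ?C" if x: "x \<in> ?C" "len x = Suc n" for x
  proof -
    have "x \<in> carrier G" using x C by (auto simp: level_def)
    then obtain s where "s \<in> \<Sigma>" "len (s \<otimes> x) \<le> n" using len_step_down x(2) by metis
    then show ?thesis using C by (force simp: level_def)
  qed
  ultimately show ?thesis by (auto simp: bd_def)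
qed

section \<open>Cone types\<close>

definition front :: "'a set \<Rightarrow> 'a set" where
  "front R = (if R = carrier G then {\<one>} else bd R)"

definition kids :: "'a set \<Rightarrow> 'a set set" where
  "kids R = comp (R - front R) ` (R - front R)"

definition gate :: "'a set \<Rightarrow> 'a" where
  "gate E = (SOME k. k \<in> bd E)"

text \<open>A type is a cone translated so that its gate, an arbitrary frontier point, becomes \<open>\<one>\<close>. Right
  translations are automorphisms of the graph with edges from \<open>g\<close> to \<open>s \<otimes> g\<close>.\<close>

inductive_set types :: "'a set set" where
  root: "carrier G \<in> types"
| kid: "R \<in> types \<Longrightarrow> E \<in> kids R \<Longrightarrow> translate E (inv (gate E)) \<in> types"

text \<open>Different kids of \<open>R\<close> can have the same type; their gates tell them
  apart.\<close>

definition edges :: "('a set \<times> 'a \<times> 'a set) set" where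
  "edges = (\<Union>R\<in>types. (\<lambda>E. (R, gate E, translate E (inv (gate E)))) ` kids R)"

lemma front_subset: "R \<subseteq> carrier G \<Longrightarrow> front R \<subseteq> R"
  by (auto simp: front_def bd_def)

lemma kids_subset: "E \<in> kids R \<Longrightarrow> E \<subseteq> R - front R"
  unfolding kids_def using comp_subset by blast

lemma kid_comp:
  assumes "R \<subseteq> carrier G" "E \<in> kids R" "x \<in> E" shows "E = comp (R - front R) x"
  using assms comp_eq[of "R - front R"] unfolding kids_def by blast

text \<open>An edge out of a component of \<open>R - front R\<close> ends in the frontier or outside
  \<open>R\<close>, and points with an edge out of \<open>R\<close> already belong to the frontier.
  The conclusion holds for whichever parent the kid is taken from.\<close>

lemma kid_exit:
  assumes R: "R \<subseteq> carrier G" and E: "E \<in> kids R" and x: "x \<in> E" and s: "s \<in> \<Sigma>" "s \<otimes> x \<notin> E"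
  shows "s \<otimes> x \<in> front R"
proof (rule ccontr)
  assume not: "s \<otimes> x \<notin> front R"
  have xR: "x \<in> R - front R" using kids_subset[OF E] x by blast
  have "s \<otimes> x \<in> R"
  proof (cases "R = carrier G")
    case True
    then show ?thesis using s xR \<Sigma> by auto
  next
    case False
    then show ?thesis using s xR by (auto simp: front_def bd_def)
  qed
  then have "s \<otimes> x \<in> comp (R - front R) x" using comp_step[OF comp_self xR s(1)] not by blast
  then show False using kid_comp[OF R E x] s(2) by simp
qed

lemma gate_bd:
  assumes R: "R \<subseteq> carrier G" and front: "front R \<noteq> {}" and E: "E \<in> kids R"
  shows "gate E \<in> bd E" "E \<noteq> carrier G"
proof -
  show ne: "E \<noteq> carrier G" using kids_subset[OF E] front front_subset[OF R] R by blast
  obtain a where "a \<in> E" using E comp_self unfolding kids_def by blast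
  moreover have "E \<subseteq> carrier G" using kids_subset[OF E] R by blast
  ultimately have "bd E \<noteq> {}" using invariant_set[of E a] ne by (auto simp: bd_def)
  then show "gate E \<in> bd E" unfolding gate_def by (simp add: some_in_eq)
qed

text \<open>Types and kids are defined from \<open>R\<close> alone, whereas the width bound speaks
  about levels. This predicate links the two; a type may occur for many \<open>n\<close> and
  \<open>h\<close>.\<close>

definition component_with_front :: "'a set \<Rightarrow> nat \<Rightarrow> 'a \<Rightarrow> 'a \<Rightarrow> bool" where
  "component_with_front R n h a \<longleftrightarrow> h \<in> carrier G \<and> a \<in> level n \<and> translate R h = comp (level n) a \<and>
     translate (front R) h = {x \<in> comp (level n) a. len x = n}"

lemma level_carrier: "level n \<subseteq> carrier G"
  by (auto simp: level_def)

lemma kid_component: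
  assumes R: "R \<subseteq> carrier G" and c: "component_with_front R n h a" and front: "front R \<noteq> {}" and E: "E \<in> kids R"
  shows "translate E (inv (gate E)) \<subseteq> carrier G" "translate E (inv (gate E)) \<noteq> carrier G"
    "\<one> \<in> bd (translate E (inv (gate E)))"
    "\<exists>h' a'. component_with_front (translate E (inv (gate E))) (Suc n) h' a'"
proof -
  let ?k = "gate E" and ?C = "comp (level n) a"
  note gate = gate_bd[OF R front E]
  have h: "h \<in> carrier G" and a: "a \<in> level n" and tR: "translate R h = ?C"
    and tF: "translate (front R) h = {x \<in> ?C. len x = n}"
    using c by (auto simp: component_with_front_def)
  have Ec: "E \<subseteq> carrier G" using kids_subset[OF E] R by blast
  have k: "?k \<in> carrier G" "?k \<in> E" using gate Ec by (auto simp: bd_def)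
  show sub: "translate E (inv ?k) \<subseteq> carrier G" using translate_carrier Ec k by simp
  show ne: "translate E (inv ?k) \<noteq> carrier G"
  proof
    assume "translate E (inv ?k) = carrier G"
    then have "E = carrier G"
      using translate_inj[OF Ec subset_refl, of "inv ?k"] translate_carrier_eq[of "inv ?k"] k by simp
    then show False using gate by simp
  qed
  have "?k \<otimes> inv ?k \<in> translate (bd E) (inv ?k)" using gate by (simp add: translate_def)
  then show one: "\<one> \<in> bd (translate E (inv ?k))" using bd_translate[OF Ec] k by simp
  obtain b where b: "b \<in> R - front R" "E = comp (R - front R) b" using E unfolding kids_def by blast
  have bc: "b \<in> carrier G" using b R by blast
  have Csub: "?C \<subseteq> level n" using comp_subset a by blast
  have "translate (R - front R) h = translate R h - translate (front R) h"
    unfolding translate_def using inj_on_image_set_diff[OF inj_translate[OF h]] R front_subset[OF R] by blast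
  then have diff: "translate (R - front R) h = ?C \<inter> level (Suc n)"
    using tR tF Csub by (auto simp: level_def)
  have bh: "b \<otimes> h \<in> ?C \<inter> level (Suc n)" using b(1) diff unfolding translate_def by blast
  have "translate E h = comp (?C \<inter> level (Suc n)) (b \<otimes> h)"
    using comp_translate[of "R - front R" h b] R h b diff by auto
  \<comment> \<open>Intersecting with \<open>?C\<close> changes nothing: a path in
    \<open>level (Suc n)\<close> is also a path in \<open>level n\<close>, so it cannot leave the
    component \<open>?C\<close>.\<close>
  also have "\<dots> = comp (level (Suc n)) (b \<otimes> h)"
  proof
    show "comp (level (Suc n)) (b \<otimes> h) \<subseteq> comp (?C \<inter> level (Suc n)) (b \<otimes> h)"
    proof
      fix x assume "x \<in> comp (level (Suc n)) (b \<otimes> h)"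
      then have "(adj (level (Suc n)))\<^sup>*\<^sup>* (b \<otimes> h) x" by (simp add: comp_def)
      then show "x \<in> comp (?C \<inter> level (Suc n)) (b \<otimes> h)"
      proof (induction rule: rtranclp_induct)
        case base
        show ?case by (rule comp_self)
      next
        case (step y z)
        obtain s where s: "s \<in> \<Sigma>" "z = s \<otimes> y" "z \<in> level (Suc n)" using step(2) by (auto simp: adj_def)
        have "y \<in> ?C" using comp_subset[OF bh] step(3) by blast
        then have "z \<in> ?C" using comp_step[of y "level n" a s] a s by (auto simp: level_def)
        then show ?case using comp_step[OF step(3) bh s(1)] s by simp
      qed
    qed
  qed (rule comp_mono, blast)
  finally have tE: "translate E h = comp (level (Suc n)) (b \<otimes> h)" .
  \<comment> \<open>Translation by \<open>?k\<close> undoes the normalisation of the gate, and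
    \<open>h\<close> then carries the kid along with its parent.\<close>
  have "translate (translate E (inv ?k)) (?k \<otimes> h) = translate E (inv ?k \<otimes> (?k \<otimes> h))"
    using Ec h k by (simp add: translate_translate)
  also have "inv ?k \<otimes> (?k \<otimes> h) = h" using h k by (simp flip: m_assoc)
  finally have tR': "translate (translate E (inv ?k)) (?k \<otimes> h) = comp (level (Suc n)) (b \<otimes> h)" using tE by simp
  moreover have "translate (front (translate E (inv ?k))) (?k \<otimes> h) = {x \<in> comp (level (Suc n)) (b \<otimes> h). len x = Suc n}"
    using bd_translate[OF sub, of "?k \<otimes> h"] h k ne tR' bd_comp_level[of "b \<otimes> h" n] bh by (simp add: front_def)
  ultimately show "\<exists>h' a'. component_with_front (translate E (inv ?k)) (Suc n) h' a'"
    unfolding component_with_front_def using h k bh by (intro exI[of _ "?k \<otimes> h"] exI[of _ "b \<otimes> h"]) simp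
qed

lemma component_root: "component_with_front (carrier G) 0 \<one> \<one>"
proof -
  have "level 0 = carrier G" by (auto simp: level_def)
  moreover have "comp (carrier G) \<one> = carrier G"
  proof (rule invariant_set)
    show sub: "comp (carrier G) \<one> \<subseteq> carrier G" by (rule comp_subset) simp
    show "\<one> \<in> comp (carrier G) \<one>" by (rule comp_self)
    show "s \<otimes> x \<in> comp (carrier G) \<one>" if "s \<in> \<Sigma>" "x \<in> comp (carrier G) \<one>" for s x
      using comp_step[OF that(2) one_closed that(1)] that sub \<Sigma>(2) by blast
  qed
  \<comment> \<open>The sphere of radius 0 is what \<open>front\<close> assigns to the whole group,
    whose boundary \<open>bd\<close> is empty; so the root fits the pattern of the other
    cones.\<close>
  moreover have "{x \<in> carrier G. len x = 0} = {\<one>}" using len_one len_eq_0 by auto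
  ultimately show ?thesis by (simp add: component_with_front_def translate_one front_def)
qed

lemma types_component:
  assumes "R \<in> types"
  shows "R \<subseteq> carrier G \<and> \<one> \<in> front R \<and> (\<exists>n h a. component_with_front R n h a)"
  using assms
proof (induction rule: types.induct)
  case root
  show ?case using component_root by (auto simp: front_def)
next
  case (kid R E)
  then obtain n h a where "component_with_front R n h a" "R \<subseteq> carrier G" "front R \<noteq> {}" by blast
  from kid_component[OF this(2,1,3) kid(2)] show ?case by (auto simp: front_def)
qed

lemma types_carrier: "R \<in> types \<Longrightarrow> R \<subseteq> carrier G"
  using types_component by blast

text \<open>The normalisation puts \<open>\<one>\<close> on the frontier, so \<open>x\<close> is
  itself a quotient of two frontier points, to which \<open>frontier_narrow\<close> applies.\<close>

lemma front_width:
  assumes "R \<in> types" shows "front R \<subseteq> width_set"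
proof
  fix x assume x: "x \<in> front R"
  obtain n h a where c: "component_with_front R n h a" and R: "R \<subseteq> carrier G" and one: "\<one> \<in> front R"
    using types_component[OF assms] by blast
  have h: "h \<in> carrier G" and a: "a \<in> level n" using c by (auto simp: component_with_front_def)
  have "y \<otimes> h \<in> {x \<in> comp (level n) a. len x = n}" if "y \<in> front R" for y
    using that c unfolding component_with_front_def translate_def by blast
  then have "x \<otimes> h \<otimes> inv (\<one> \<otimes> h) \<in> width_set" using frontier_narrow[OF a] x one by blast
  moreover have "x \<in> carrier G" using x R front_subset by blast
  ultimately show "x \<in> width_set" using h by (simp add: m_assoc)
qed

lemma finite_front: "R \<in> types \<Longrightarrow> finite (front R)"
  using front_width finite_width_set finite_subset by blast

text \<open>Up to translation a cone is the component of \<open>\<one>\<close> in the complement of its outer boundary, which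
  lies in a fixed finite set.\<close>

lemma finite_types: "finite types"
proof -
  define Z where "Z = (\<lambda>(s, f). s \<otimes> f) ` (\<Sigma> \<times> width_set)"
  have "types \<subseteq> insert (carrier G) ((\<lambda>Y. comp (carrier G - Y) \<one>) ` Pow Z)"
  proof
    fix R assume R: "R \<in> types"
    show "R \<in> insert (carrier G) ((\<lambda>Y. comp (carrier G - Y) \<one>) ` Pow Z)"
    proof (cases "R = carrier G")
      case False
      obtain n h a where c: "component_with_front R n h a" and Rc: "R \<subseteq> carrier G" and one: "\<one> \<in> R"
        using types_component[OF R] front_subset by blast
      have h: "h \<in> carrier G" and a: "a \<in> level n" and tR: "translate R h = comp (level n) a"
        using c by (auto simp: component_with_front_def)
      define Y where "Y = (\<lambda>(s, f). s \<otimes> f) ` (\<Sigma> \<times> bd R) - R"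
      have "Y \<subseteq> Z" using front_width[OF R] False unfolding Y_def Z_def front_def by auto
      \<comment> \<open>A translate of \<open>R\<close> is a component and thus connected;
        translating back shows that \<open>R\<close> is connected.\<close>
      have "\<one> \<otimes> h \<in> comp (level n) a" using one tR unfolding translate_def by blast
      then have "translate R h \<subseteq> comp (translate R h) (\<one> \<otimes> h)"
        using comp_connected[OF level_carrier a] unfolding tR by (auto simp: comp_def)
      then have "translate R h \<subseteq> translate (comp R \<one>) h" using comp_translate[OF Rc h one] by simp
      then have "translate R h = translate (comp R \<one>) h" using comp_subset[OF one] unfolding translate_def by blast
      then have "R = comp R \<one>" using translate_inj[OF Rc _ h] comp_subset[OF one] Rc by blast
      moreover have "comp R \<one> \<subseteq> comp (carrier G - Y) \<one>" by (rule comp_mono) (use Rc in \<open>auto simp: Y_def\<close>)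
      \<comment> \<open>The first step out of \<open>R\<close> would end in the removed set
        \<open>Y\<close>.\<close>
      moreover have "x \<in> R" if "(adj (carrier G - Y))\<^sup>*\<^sup>* \<one> x" for x
        using that
      proof (induction rule: rtranclp_induct)
        case (step y z)
        show ?case
        proof (rule ccontr)
          assume "z \<notin> R"
          moreover obtain s where s: "s \<in> \<Sigma>" "z = s \<otimes> y" "z \<notin> Y" using step(2) by (auto simp: adj_def)
          ultimately have "y \<in> bd R" using step(3) by (auto simp: bd_def)
          then show False using s \<open>z \<notin> R\<close> by (auto simp: Y_def)
        qed
      qed (rule one)
      ultimately have "R = comp (carrier G - Y) \<one>" unfolding comp_def by blast
      then show ?thesis using \<open>Y \<subseteq> Z\<close> by blast
    qed simp
  qed
  moreover have "finite Z" unfolding Z_def using \<Sigma>(1) finite_width_set by simp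
  ultimately show ?thesis by (meson finite_Pow_iff finite_imageI finite_insert finite_subset)
qed

text \<open>The gate of a kid is adjacent to the finite frontier of the parent, and it determines
  the kid as its component.\<close>

lemma finite_kids:
  assumes R: "R \<in> types" shows "finite (kids R)"
proof -
  have Rc: "R \<subseteq> carrier G" and ne: "front R \<noteq> {}" using types_component[OF R] by blast+
  have "kids R \<subseteq> comp (R - front R) ` (\<lambda>(s, f). s \<otimes> f) ` (\<Sigma> \<times> front R)"
  proof
    fix E assume E: "E \<in> kids R"
    obtain s where s: "s \<in> \<Sigma>" "s \<otimes> gate E \<notin> E" "gate E \<in> E"
      using gate_bd(1)[OF Rc ne E] by (auto simp: bd_def)
    have f: "s \<otimes> gate E \<in> front R" using kid_exit[OF Rc E s(3,1,2)] .
    have "s \<in> carrier G" "gate E \<in> carrier G" using s \<Sigma> kids_subset[OF E] Rc by blast+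
    then have "gate E = inv s \<otimes> (s \<otimes> gate E)" by (simp flip: m_assoc)
    then have "gate E \<in> (\<lambda>(s, f). s \<otimes> f) ` (\<Sigma> \<times> front R)" using f \<Sigma>(3)[OF s(1)] by force
    then show "E \<in> comp (R - front R) ` (\<lambda>(s, f). s \<otimes> f) ` (\<Sigma> \<times> front R)"
      using kid_comp[OF Rc E s(3)] by blast
  qed
  then show ?thesis using \<Sigma>(1) finite_front[OF R] by (meson finite_SigmaI finite_imageI finite_subset)
qed

lemma edgesD:
  assumes "(R, k, S) \<in> edges"
  shows "\<exists>E. R \<in> types \<and> E \<in> kids R \<and> k = gate E \<and> S = translate E (inv k) \<and> k \<in> carrier G \<and>
    E \<subseteq> carrier G \<and> (\<forall>x\<in>carrier G. x \<in> S \<longleftrightarrow> x \<otimes> k \<in> E)"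
proof -
  obtain E where E: "R \<in> types" "E \<in> kids R" "k = gate E" "S = translate E (inv k)"
    using assms unfolding edges_def by blast
  have R: "R \<subseteq> carrier G" "front R \<noteq> {}" using types_component[OF E(1)] by blast+
  have k: "k \<in> bd E" using gate_bd[OF R E(2)] E by simp
  have Ec: "E \<subseteq> carrier G" using kids_subset[OF E(2)] R by blast
  have kc: "k \<in> E" "k \<in> carrier G" using k Ec by (auto simp: bd_def)
  have "x \<in> S \<longleftrightarrow> x \<otimes> k \<in> E" if x: "x \<in> carrier G" for x
    using translate_mem_iff[OF Ec, of "inv k" "x \<otimes> k"] x kc E(4) by (simp add: m_assoc)
  then show ?thesis using E kc(2) Ec by blast
qed

sublocale cone_tree G \<Sigma> types front edges "carrier G"
proof
  show "\<Sigma> \<subseteq> carrier G" "generate G \<Sigma> = carrier G" "\<And>s. s \<in> \<Sigma> \<Longrightarrow> inv s \<in> \<Sigma>" using \<Sigma> by auto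
  show "finite types" by (rule finite_types)
  show "finite (front R)" if "R \<in> types" for R using that by (rule finite_front)
  show "finite edges" unfolding edges_def using finite_types finite_kids by simp
  show "R \<subseteq> carrier G" if "R \<in> types" for R using that by (rule types_carrier)
  show "front R \<subseteq> R" if "R \<in> types" for R using that types_carrier front_subset by blast
  show "R \<in> types \<and> k \<in> carrier G \<and> S \<in> types" if "(R, k, S) \<in> edges" for R k S
    using edgesD[OF that] by (elim exE conjE) (auto intro: types.kid)
  show "x \<otimes> k \<in> R - front R" if e: "(R, k, S) \<in> edges" and x: "x \<in> S" for R k S x
  proof -
    obtain E where E: "R \<in> types" "E \<in> kids R" "k = gate E" "S = translate E (inv k)" "k \<in> carrier G"
      "E \<subseteq> carrier G" "\<forall>x\<in>carrier G. x \<in> S \<longleftrightarrow> x \<otimes> k \<in> E" using edgesD[OF e] by (elim exE conjE)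
    have "x \<in> carrier G" using translate_carrier[OF E(6), of "inv k"] x E(4,5) by auto
    then show ?thesis using E(7) x kids_subset[OF E(2)] by blast
  qed
  show "k = k' \<and> S = S'" if e: "(R, k, S) \<in> edges" "(R, k', S') \<in> edges" and x: "x \<in> S" "x' \<in> S'"
    and eq: "x \<otimes> k = x' \<otimes> k'" for R k S k' S' x x'
  proof -
    obtain E where E: "R \<in> types" "E \<in> kids R" "k = gate E" "S = translate E (inv k)" "k \<in> carrier G"
      "E \<subseteq> carrier G" "\<forall>x\<in>carrier G. x \<in> S \<longleftrightarrow> x \<otimes> k \<in> E" using edgesD[OF e(1)] by (elim exE conjE)
    obtain E' where E': "R \<in> types" "E' \<in> kids R" "k' = gate E'" "S' = translate E' (inv k')" "k' \<in> carrier G"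
      "E' \<subseteq> carrier G" "\<forall>x\<in>carrier G. x \<in> S' \<longleftrightarrow> x \<otimes> k' \<in> E'" using edgesD[OF e(2)] by (elim exE conjE)
    have "x \<in> carrier G" using translate_carrier[OF E(6), of "inv k"] x(1) E(4,5) by auto
    moreover have "x' \<in> carrier G" using translate_carrier[OF E'(6), of "inv k'"] x(2) E'(4,5) by auto
    ultimately have mem: "x \<otimes> k \<in> E" "x \<otimes> k \<in> E'" using E(7) E'(7) x eq by auto
    have "E = E'"
      using kid_comp[OF types_carrier[OF E(1)] E(2) mem(1)] kid_comp[OF types_carrier[OF E(1)] E'(2) mem(2)] by simp
    then show ?thesis using E E' by simp
  qed
  show "s \<otimes> f \<in> front R \<or> (\<exists>k S. (R, k, S) \<in> edges \<and> s \<otimes> f \<otimes> inv k \<in> front S) \<or>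
      (\<exists>S k. (S, k, R) \<in> edges) \<and> (\<forall>S k. (S, k, R) \<in> edges \<longrightarrow> s \<otimes> f \<otimes> k \<in> front S)"
    if s: "s \<in> \<Sigma>" and R: "R \<in> types" and f: "f \<in> front R" for s R f
  proof -
    have Rc: "R \<subseteq> carrier G" and ne: "front R \<noteq> {}" using types_component[OF R] by blast+
    have fR: "f \<in> R" using f front_subset[OF Rc] by blast
    have c: "s \<in> carrier G" "f \<in> carrier G" using s \<Sigma> fR Rc by auto
    consider "s \<otimes> f \<in> front R" | "s \<otimes> f \<in> R - front R" | "s \<otimes> f \<notin> R" by blast
    then show ?thesis
    proof cases
      case 2
      \<comment> \<open>The point enters a kid \<open>E\<close> and lies on the frontier of
        \<open>E\<close>, because the inverse letter leads back to \<open>f\<close> outside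
        \<open>E\<close>.\<close>
      define E where "E = comp (R - front R) (s \<otimes> f)"
      have E: "E \<in> kids R" using 2 unfolding E_def kids_def by blast
      have Ec: "E \<subseteq> carrier G" using kids_subset[OF E] Rc by blast
      have "f \<notin> E" using kids_subset[OF E] f by blast
      moreover have "inv s \<otimes> (s \<otimes> f) = f" using c by (simp flip: m_assoc)
      ultimately have "s \<otimes> f \<in> bd E" using \<Sigma>(3)[OF s] comp_self unfolding bd_def E_def by force
      have k: "gate E \<in> carrier G" using gate_bd(1)[OF Rc ne E] Ec by (auto simp: bd_def)
      obtain n h a where comp: "component_with_front R n h a" using types_component[OF R] by blast
      have "translate E (inv (gate E)) \<noteq> carrier G" using kid_component(2)[OF Rc comp ne E] .
      then have "s \<otimes> f \<otimes> inv (gate E) \<in> front (translate E (inv (gate E)))"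
        using \<open>s \<otimes> f \<in> bd E\<close> bd_translate[OF Ec, of "inv (gate E)"] k by (simp add: front_def translate_def)
      moreover have "(R, gate E, translate E (inv (gate E))) \<in> edges" using R E unfolding edges_def by blast
      ultimately show ?thesis by blast
    next
      case 3
      then have "R \<noteq> carrier G" using c by auto
      with R have "\<exists>S k. (S, k, R) \<in> edges" by (cases rule: types.cases) (auto simp: edges_def)
      \<comment> \<open>Each edge into \<open>R\<close> presents \<open>R\<close> as a translated
        kid of \<open>S\<close>, and \<open>kid_exit\<close> treats all these parents alike.\<close>
      moreover have "s \<otimes> f \<otimes> k \<in> front S" if e: "(S, k, R) \<in> edges" for S k
      proof -
        obtain E where E: "S \<in> types" "E \<in> kids S" "k = gate E" "R = translate E (inv k)" "k \<in> carrier G" "E \<subseteq> carrier G"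
          and mem: "\<forall>x\<in>carrier G. x \<in> R \<longleftrightarrow> x \<otimes> k \<in> E" using edgesD[OF e] by (elim exE conjE)
        have "f \<otimes> k \<in> E" using mem c(2) fR by blast
        moreover have "s \<otimes> f \<otimes> k \<notin> E" using mem c 3 by blast
        ultimately have "f \<otimes> k \<in> E" "s \<otimes> (f \<otimes> k) \<notin> E" using c E(5) by (auto simp: m_assoc)
        then show ?thesis using kid_exit[OF types_carrier[OF E(1)] E(2) _ s] c E by (simp add: m_assoc)
      qed
      ultimately show ?thesis by blast
    qed blast
  qed
  show "carrier G \<in> types" by (rule types.root)
  show "\<one> \<in> front (carrier G)" by (simp add: front_def)
  show "(S, k, carrier G) \<notin> edges" for S k
  proof
    assume "(S, k, carrier G) \<in> edges"
    from edgesD[OF this] obtain E where E: "S \<in> types" "E \<in> kids S" "carrier G = translate E (inv (gate E))" by blast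
    \<comment> \<open>A kid misses the nonempty frontier of its parent, so its translate is not the
      whole group.\<close>
    obtain n h a where "component_with_front S n h a" "S \<subseteq> carrier G" "front S \<noteq> {}" using types_component[OF E(1)] by blast
    then show False using kid_component(2)[OF _ _ _ E(2)] E(3) by metis
  qed
qed

end

lemma CF_group_demonstrative_action:
  fixes T :: "('t, 'y) monoid_scheme"
  assumes "CF_group T"
  shows "finitely_generated T \<and> (\<exists>(Q :: ('t set \<times> 't) set) q \<alpha>. finite Q \<and> q \<in> Q \<and> cantor_action T Q \<alpha> \<and>
     (\<forall>t\<in>carrier T. \<forall>z z'. \<alpha> t (q, z) = (q, z') \<longrightarrow> t = \<one>\<^bsub>T\<^esub>))"
proof -
  obtain \<Sigma> where T: "group T" and \<Sigma>: "finite \<Sigma>" "\<Sigma> \<subseteq> carrier T" "\<And>s. s \<in> \<Sigma> \<Longrightarrow> inv\<^bsub>T\<^esub> s \<in> \<Sigma>"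
    "generate T \<Sigma> = carrier T" and cf: "context_free \<Sigma> (word_problem T \<Sigma>)"
    using assms unfolding CF_group_def by blast
  from group.context_free_chords[OF T \<Sigma>(2) cf]
  obtain P where P: "finite P" "P \<subseteq> carrier T"
    and chords: "\<forall>x1 x2 x3. x1 @ x2 @ x3 \<in> word_problem T \<Sigma> \<longrightarrow>
      (\<exists>x11 x12 x21 x22 x31 x32. x1 = x11 @ x12 \<and> x2 = x21 @ x22 \<and> x3 = x31 @ x32 \<and>
         foldr (\<otimes>\<^bsub>T\<^esub>) (x12 @ x21) \<one>\<^bsub>T\<^esub> \<in> P \<and> foldr (\<otimes>\<^bsub>T\<^esub>) (x22 @ x31) \<one>\<^bsub>T\<^esub> \<in> P)"
    by (elim exE conjE)
  interpret cayley_graph T \<Sigma> P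
    by (intro cayley_graph.intro cayley_graph_axioms.intro T \<Sigma> P chords[rule_format])
  show ?thesis using ex_demonstrative_action \<Sigma> unfolding finitely_generated_def by blast
qed

theorem corollary3:
  shows
    "(\<forall>(G :: ('a, 'x) monoid_scheme) H.
        fg_subgroup_of_V G \<and> subgroup H G \<and> finitely_generated (G\<lparr>carrier := H\<rparr>)
        \<longrightarrow> fg_subgroup_of_V (G\<lparr>carrier := H\<rparr>)) \<and>
     (\<forall>(H :: ('b, 'y) monoid_scheme) G.
        group H \<and> subgroup G H \<and> finite (rcosets\<^bsub>H\<^esub> G) \<and> fg_subgroup_of_V (H\<lparr>carrier := G\<rparr>)
        \<longrightarrow> fg_subgroup_of_V H) \<and>
     (\<forall>(k :: nat) (G :: nat \<Rightarrow> ('c, 'z) monoid_scheme).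
        (\<forall>i\<in>{1..k}. fg_subgroup_of_V (G i)) \<longrightarrow> fg_subgroup_of_V (product_group {1..k} G)) \<and>
     (\<forall>(G :: ('d, 'u) monoid_scheme) (T :: ('e, 'v) monoid_scheme).
        fg_subgroup_of_V G \<and> CF_group T \<longrightarrow> fg_subgroup_of_V (restricted_wreath_product G T))"
proof (intro conjI allI impI)
  fix G :: "('a, 'x) monoid_scheme" and H
  assume "fg_subgroup_of_V G \<and> subgroup H G \<and> finitely_generated (G\<lparr>carrier := H\<rparr>)"
  then show "fg_subgroup_of_V (G\<lparr>carrier := H\<rparr>)" using fg_subgroup_of_V_subgroup by blast
next
  fix H :: "('b, 'y) monoid_scheme" and G
  assume "group H \<and> subgroup G H \<and> finite (rcosets\<^bsub>H\<^esub> G) \<and> fg_subgroup_of_V (H\<lparr>carrier := G\<rparr>)"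
  then show "fg_subgroup_of_V H" using fg_subgroup_of_V_finite_index by blast
next
  fix k :: nat and G :: "nat \<Rightarrow> ('c, 'z) monoid_scheme"
  assume "\<forall>i\<in>{1..k}. fg_subgroup_of_V (G i)"
  then show "fg_subgroup_of_V (product_group {1..k} G)" using fg_subgroup_of_V_product_group by blast
next
  fix G :: "('d, 'u) monoid_scheme" and T :: "('e, 'v) monoid_scheme"
  assume V: "fg_subgroup_of_V G \<and> CF_group T"
  then interpret wreath G T
    by (intro wreath.intro) (auto simp: fg_subgroup_of_V_def CF_group_def)
  obtain Q :: "('e set \<times> 'e) set" and q \<alpha> where "finite Q" "q \<in> Q" "cantor_action T Q \<alpha>"
    and disj: "\<forall>t\<in>carrier T. \<forall>z z'. \<alpha> t (q, z) = (q, z') \<longrightarrow> t = \<one>\<^bsub>T\<^esub>"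
    using CF_group_demonstrative_action[of T] V by (elim conjE exE) blast
  then show "fg_subgroup_of_V (restricted_wreath_product G T)"
    using CF_group_demonstrative_action[of T] V by (intro fg_subgroup_of_V_W[of Q q \<alpha>]) blast+
qed

end
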